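(* Let $N>2$ and let $M\subseteq\mathbb{R}^N$ be the set of all vectors of a maximal collection of $N/2+1$ pairwise mutually unbiased orthonormal bases of $\mathbb{R}^N$, and let $X=M\cup(-M)$. Let $u,v\in X$ with $(u,v)=0$, put $Y'=\{x\in X: (u,x)=(v,x)=\frac{1}{\sqrt N}\}$, and let $Y$ be the set obtained by orthogonally projecting the vectors of $Y'$ onto $\langle u,v\rangle^{\perp}$ and rescaling them to unit length. Put $\alpha=\frac{-\sqrt N-2}{N-2}$, $\beta=\frac{\sqrt N-2}{N-2}$, $\gamma=\frac{-2}{N-2}$. Then the inner products of distinct elements of $Y$ lie in $\{\alpha,\beta,\gamma\}$, and the relations $R_0$ (equality), $R_1$ (inner product $\alpha$), $R_2$ (inner product $\beta$), $R_3$ (inner product $\gamma$) make $Y$ a three-class association scheme with first and second eigenmatrices $$P=\begin{pmatrix} 1 & \frac{(N-2\sqrt{N})(N-2)}{8} & \frac{(N+2\sqrt{N})(N-2)}{8} & \frac{N}{2}-1 \\ 1 & -\frac{\sqrt{N}(N-4)}{8} & \frac{\sqrt{N}(N-4)}{8} & -1 \\ 1 & \frac{\sqrt{N}}{2} & -\frac{\sqrt{N}}{2} & -1 \\ 1 & -\frac{N-2\sqrt{N}}{4} & -\frac{N+2\sqrt{N}}{4} & \frac{N}{2}-1 \end{pmatrix},\qquad Q=\begin{pmatrix} 1 & N-2 & \frac{(N-2)(N-4)}{4} & \frac{N}{2}-1 \\ 1 & -\sqrt{N}-2 & \sqrt{N}+2 & -1 \\ 1 & \sqrt{N}-2 & -\sqrt{N}+2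 & -1 \\ 1 & -2 & -\frac{N}{2}+2 & \frac{N}{2}-1 \end{pmatrix}.$$
   Context: Two orthonormal bases $\mathcal{B},\mathcal{B}'$ of $\mathbb{R}^N$ are mutually unbiased if $|(x,y)|=1/\sqrt N$ for all $x\in\mathcal{B}$, $y\in\mathcal{B}'$. At most $N/2+1$ pairwise mutually unbiased bases exist in $\mathbb{R}^N$; a maximal collection is one attaining $N/2+1$. Eigenmatrix conventions: for a scheme with adjacency matrices $A_j$ and primitive idempotents $E_i$, $A_j=\sum_i P_{ij}E_i$ and $E_j=\frac{1}{|Y|}\sum_i Q_{ij}A_i$.
   Formalization: For N=4 the claim fails strictly: α=-2 is no inner product of unit vectors, so R_1 is empty and E_2=0; there the scheme and eigenmatrices P, Q are asserted allowing empty relations and zero matrices among the E_i. For all other N>2 the full claim is proved. *)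

theory Defs
  imports "HOL-Analysis.Analysis"
begin

definition orthonormal_basis :: "'a::euclidean_space set \<Rightarrow> bool" where
  "orthonormal_basis B \<longleftrightarrow> pairwise orthogonal B \<and> (\<forall>x\<in>B. norm x = 1) \<and> span B = UNIV"

definition mutually_unbiased :: "'a::euclidean_space set \<Rightarrow> 'a set \<Rightarrow> bool" where
  "mutually_unbiased B B' \<longleftrightarrow> (\<forall>x\<in>B. \<forall>y\<in>B'. \<bar>x \<bullet> y\<bar> = 1 / sqrt (real DIM('a)))"

(* The cardinality is compared in the reals, so the equation also forces the dimension to be even. *)
definition maximal_mub_collection :: "'a::euclidean_space set set \<Rightarrow> bool" where
  "maximal_mub_collection \<B> \<longleftrightarrow>
     (\<forall>B\<in>\<B>. orthonormal_basis B) \<and> pairwise mutually_unbiased \<B> \<and>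
     real (card \<B>) = real DIM('a) / 2 + 1"

definition orthogonal_projection :: "'a::euclidean_space set \<Rightarrow> 'a \<Rightarrow> 'a" where
  "orthogonal_projection S x = (THE p. p \<in> S \<and> x - p \<in> S\<^sup>\<bottom>)"

definition rescale_to_unit :: "'a::euclidean_space \<Rightarrow> 'a" where
  "rescale_to_unit x = (1 / norm x) *\<^sub>R x"

definition inner_product_relation :: "'a::euclidean_space set \<Rightarrow> real \<Rightarrow> ('a \<times> 'a) set" where
  "inner_product_relation Y c = {(x, y). x \<in> Y \<and> y \<in> Y \<and> x \<bullet> y = c}"

(* Symmetric association schemes with relations R 0, ..., R d, some of which may be empty. *)
definition weak_association_scheme :: "'a set \<Rightarrow> nat \<Rightarrow> (nat \<Rightarrow> ('a \<times> 'a) set) \<Rightarrow> bool" where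
  "weak_association_scheme Y d R \<longleftrightarrow>
     finite Y \<and> Y \<noteq> {} \<and>
     R 0 = Id_on Y \<and>
     (\<Union>i\<le>d. R i) = Y \<times> Y \<and>
     (\<forall>i\<le>d. \<forall>j\<le>d. i \<noteq> j \<longrightarrow> R i \<inter> R j = {}) \<and>
     (\<forall>i\<le>d. sym (R i)) \<and>
     (\<forall>h\<le>d. \<forall>i\<le>d. \<forall>j\<le>d. \<exists>p::nat. \<forall>(x, y)\<in>R h.
        card {z \<in> Y. (x, z) \<in> R i \<and> (z, y) \<in> R j} = p)"

definition association_scheme :: "'a set \<Rightarrow> nat \<Rightarrow> (nat \<Rightarrow> ('a \<times> 'a) set) \<Rightarrow> bool" where
  "association_scheme Y d R \<longleftrightarrow> weak_association_scheme Y d R \<and> (\<forall>i\<le>d. R i \<noteq> {})"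

(* A real matrix with rows and columns indexed by the finite set Y is a function of two arguments
   that vanishes outside Y \<times> Y. *)
type_synonym 'a matrix_on = "'a \<Rightarrow> 'a \<Rightarrow> real"

definition zero_matrix :: "'a matrix_on" where
  "zero_matrix = (\<lambda>x y. 0)"

definition matrix_product :: "'a set \<Rightarrow> 'a matrix_on \<Rightarrow> 'a matrix_on \<Rightarrow> 'a matrix_on" where
  "matrix_product Y A B = (\<lambda>x y. \<Sum>z\<in>Y. A x z * B z y)"

definition adjacency_matrix :: "('a \<times> 'a) set \<Rightarrow> 'a matrix_on" where
  "adjacency_matrix r = (\<lambda>x y. of_bool ((x, y) \<in> r))"

definition bose_mesner_algebra :: "nat \<Rightarrow> (nat \<Rightarrow> ('a \<times> 'a) set) \<Rightarrow> 'a matrix_on set" where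
  "bose_mesner_algebra d R =
     {(\<lambda>x y. \<Sum>i\<le>d. c i * adjacency_matrix (R i) x y) | c. True}"

definition primitive_idempotents :: "'a set \<Rightarrow> 'a matrix_on set \<Rightarrow> 'a matrix_on set" where
  "primitive_idempotents Y \<A> =
     {E \<in> \<A>. E \<noteq> zero_matrix \<and> matrix_product Y E E = E \<and>
        (\<forall>F\<in>\<A>. matrix_product Y F F = F \<and> matrix_product Y E F = F \<and> matrix_product Y F E = F
           \<longrightarrow> F = zero_matrix \<or> F = E)}"

definition eigenmatrix_equations ::
  "'a set \<Rightarrow> nat \<Rightarrow> (nat \<Rightarrow> ('a \<times> 'a) set) \<Rightarrow> (nat \<Rightarrow> 'a matrix_on) \<Rightarrow>
     (nat \<Rightarrow> nat \<Rightarrow> real) \<Rightarrow> (nat \<Rightarrow> nat \<Rightarrow> real) \<Rightarrow> bool" where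
  "eigenmatrix_equations Y d R E P Q \<longleftrightarrow>
     E 0 = (\<lambda>x y. of_bool (x \<in> Y \<and> y \<in> Y) / real (card Y)) \<and>
     (\<forall>j\<le>d. adjacency_matrix (R j) = (\<lambda>x y. \<Sum>i\<le>d. P i j * E i x y)) \<and>
     (\<forall>j\<le>d. E j = (\<lambda>x y. 1 / real (card Y) * (\<Sum>i\<le>d. Q i j * adjacency_matrix (R i) x y)))"

definition eigenmatrices ::
  "'a set \<Rightarrow> nat \<Rightarrow> (nat \<Rightarrow> ('a \<times> 'a) set) \<Rightarrow>
     (nat \<Rightarrow> nat \<Rightarrow> real) \<Rightarrow> (nat \<Rightarrow> nat \<Rightarrow> real) \<Rightarrow> bool" where
  "eigenmatrices Y d R P Q \<longleftrightarrow>
     (\<exists>E. bij_betw E {..d} (primitive_idempotents Y (bose_mesner_algebra d R)) \<and>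
          eigenmatrix_equations Y d R E P Q)"

(* If some relations are empty, the algebra has fewer than d + 1 primitive idempotents, and
   the list E 0, ..., E d enumerates them without repetition, padded by zero matrices. *)
definition weak_eigenmatrices ::
  "'a set \<Rightarrow> nat \<Rightarrow> (nat \<Rightarrow> ('a \<times> 'a) set) \<Rightarrow>
     (nat \<Rightarrow> nat \<Rightarrow> real) \<Rightarrow> (nat \<Rightarrow> nat \<Rightarrow> real) \<Rightarrow> bool" where
  "weak_eigenmatrices Y d R P Q \<longleftrightarrow>
     (\<exists>E. bij_betw E {i. i \<le> d \<and> E i \<noteq> zero_matrix}
            (primitive_idempotents Y (bose_mesner_algebra d R)) \<and>
          eigenmatrix_equations Y d R E P Q)"

end

theory Submission
  imports Defs
begin

text \<open>
  Let \<open>B\<^sub>0\<close> be the basis containing \<open>u\<close> and \<open>v\<close> up to sign. Any other basis \<open>B\<close> contributes to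
  \<open>Y'\<close>, up to sign, those \<open>b \<in> B\<close> with \<open>u \<bullet> b = v \<bullet> b\<close>, which is half of \<open>B\<close> since \<open>u\<close> is orthogonal
  to \<open>v\<close>. After projection these \<open>N / 2\<close> vectors form a regular simplex; the simplices are the classes
  of the equivalence relation \<open>R\<^sub>0 \<union> R\<^sub>3\<close>, and each of them sums to zero.

  The number of bases is such that the sum of all \<open>(x \<bullet> y)\<^sup>4\<close> over \<open>x, y \<in> M\<close> attains the design bound,
  so \<open>M\<close> has the fourth moments of the sphere. Weighting \<open>b\<close> by \<open>(1 + N (u \<bullet> b) (v \<bullet> b)) / 2\<close>, which is
  the indicator of \<open>Y'\<close> off \<open>B\<^sub>0\<close>, then shows that \<open>Y\<close> is a tight frame of the orthogonal complement of
  \<open>u\<close> and \<open>v\<close>. Hence the Gram matrix of \<open>Y\<close>, the averaging matrix, and the averaging matrix over the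
  simplices are, up to scaling, idempotents; together with the identity they yield four orthogonal
  idempotents with the same span as the adjacency matrices. Closure of this span under multiplication
  gives the intersection numbers.
\<close>

section \<open>Association schemes from orthogonal idempotents\<close>

lemma matrix_product_sum_left:
  "matrix_product Y (\<lambda>x y. \<Sum>i\<in>I. c i * A i x y) B = (\<lambda>x y. \<Sum>i\<in>I. c i * matrix_product Y (A i) B x y)"
  by (simp add: matrix_product_def sum_distrib_left sum_distrib_right sum.swap[of _ I] mult.assoc)

lemma matrix_product_sum_right:
  "matrix_product Y B (\<lambda>x y. \<Sum>i\<in>I. c i * A i x y) = (\<lambda>x y. \<Sum>i\<in>I. c i * matrix_product Y B (A i) x y)"
  by (simp add: matrix_product_def sum_distrib_left sum.swap[of _ I] mult.left_commute)

lemma matrix_product_diff_left: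
  "matrix_product Y (\<lambda>x y. A x y - B x y) C = (\<lambda>x y. matrix_product Y A C x y - matrix_product Y B C x y)"
  by (simp add: matrix_product_def left_diff_distrib sum_subtractf)

lemma matrix_product_diff_right:
  "matrix_product Y C (\<lambda>x y. A x y - B x y) = (\<lambda>x y. matrix_product Y C A x y - matrix_product Y C B x y)"
  by (simp add: matrix_product_def right_diff_distrib sum_subtractf)

locale orthogonal_idempotents =
  fixes Y :: "'a set" and d :: nat and R :: "nat \<Rightarrow> ('a \<times> 'a) set"
    and E :: "nat \<Rightarrow> 'a matrix_on" and P Q :: "nat \<Rightarrow> nat \<Rightarrow> real"
  assumes finite: "finite Y" and nonempty: "Y \<noteq> {}"
    and R_0: "R 0 = Id_on Y"
    and R_cover: "(\<Union>i\<le>d. R i) = Y \<times> Y"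
    and R_disjoint: "\<And>i j. i \<le> d \<Longrightarrow> j \<le> d \<Longrightarrow> i \<noteq> j \<Longrightarrow> R i \<inter> R j = {}"
    and R_sym: "\<And>i. i \<le> d \<Longrightarrow> sym (R i)"
    and E_product: "\<And>i j. i \<le> d \<Longrightarrow> j \<le> d \<Longrightarrow>
      matrix_product Y (E i) (E j) = (if i = j then E i else zero_matrix)"
    and equations: "eigenmatrix_equations Y d R E P Q"
begin

section \<open>Multiplication in the span of the idempotents, and intersection numbers\<close>

lemma adjacency_eq:
  "j \<le> d \<Longrightarrow> adjacency_matrix (R j) = (\<lambda>x y. \<Sum>i\<le>d. P i j * E i x y)"
  using equations by (simp add: eigenmatrix_equations_def)

lemma E_eq:
  "j \<le> d \<Longrightarrow> E j = (\<lambda>x y. 1 / real (card Y) * (\<Sum>i\<le>d. Q i j * adjacency_matrix (R i) x y))"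
  using equations by (simp add: eigenmatrix_equations_def)

text \<open>Orthogonality kills every term but the \<open>j\<close>-th, so \<open>c j\<close> is the
  eigenvalue of the combination on the range of \<open>E j\<close>.\<close>

lemma product_combination:
  assumes "j \<le> d"
  shows "matrix_product Y (\<lambda>x y. \<Sum>i\<le>d. c i * E i x y) (E j) = (\<lambda>x y. c j * E j x y)"
    and "matrix_product Y (E j) (\<lambda>x y. \<Sum>i\<le>d. c i * E i x y) = (\<lambda>x y. c j * E j x y)"
proof -
  have "(\<Sum>i\<le>d. c i * (if i = j then E i else zero_matrix) x y) = c j * E j x y"
       "(\<Sum>i\<le>d. c i * (if j = i then E j else zero_matrix) x y) = c j * E j x y" for x y
    using assms by (auto simp: if_distrib[of "\<lambda>f. f x y"] zero_matrix_def if_distrib[of "\<lambda>z. c _ * z"]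
        sum.delta sum.delta' cong: if_cong)
  then show "matrix_product Y (\<lambda>x y. \<Sum>i\<le>d. c i * E i x y) (E j) = (\<lambda>x y. c j * E j x y)"
    and "matrix_product Y (E j) (\<lambda>x y. \<Sum>i\<le>d. c i * E i x y) = (\<lambda>x y. c j * E j x y)"
    using assms by (simp_all add: matrix_product_sum_left matrix_product_sum_right E_product)
qed

lemma adjacency_product:
  assumes "i \<le> d" "j \<le> d"
  shows "matrix_product Y (adjacency_matrix (R i)) (adjacency_matrix (R j)) =
    (\<lambda>x y. \<Sum>k\<le>d. P k i * P k j * E k x y)"
proof -
  have "matrix_product Y (adjacency_matrix (R i)) (adjacency_matrix (R j)) =
      (\<lambda>x y. \<Sum>k\<le>d. P k j * matrix_product Y (adjacency_matrix (R i)) (E k) x y)"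
    by (simp add: adjacency_eq[OF assms(2)] matrix_product_sum_right)
  also have "\<dots> = (\<lambda>x y. \<Sum>k\<le>d. P k i * P k j * E k x y)"
    by (intro ext sum.cong) (simp_all add: adjacency_eq[OF assms(1)] product_combination mult_ac)
  finally show ?thesis .
qed

lemma card_eq_product:
  assumes "i \<le> d" "j \<le> d"
  shows "real (card {z \<in> Y. (x, z) \<in> R i \<and> (z, y) \<in> R j}) =
    matrix_product Y (adjacency_matrix (R i)) (adjacency_matrix (R j)) x y"
proof -
  have "real (card {z \<in> Y. (x, z) \<in> R i \<and> (z, y) \<in> R j}) =
      (\<Sum>z\<in>Y. of_bool ((x, z) \<in> R i \<and> (z, y) \<in> R j))"
    using finite by (simp add: sum.If_cases of_bool_def Int_def)
  then show ?thesis by (simp add: matrix_product_def adjacency_matrix_def of_bool_conj)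
qed

lemma adjacency_eq_delta:
  assumes "h \<le> d" "i \<le> d" "(x, y) \<in> R h"
  shows "adjacency_matrix (R i) x y = (if i = h then 1 else 0)"
  using assms R_disjoint[of i h] by (auto simp: adjacency_matrix_def)

text \<open>The count in question is an entry of a product of two adjacency matrices. This product
  is a combination of the \<open>E k\<close>, whose entries are constant on each relation.\<close>

lemma weak_association_scheme: "weak_association_scheme Y d R"
proof -
  have "\<exists>p::nat. \<forall>(x, y)\<in>R h. card {z \<in> Y. (x, z) \<in> R i \<and> (z, y) \<in> R j} = p"
    if h: "h \<le> d" and i: "i \<le> d" and j: "j \<le> d" for h i j
  proof -
    \<comment> \<open>The intersection number in terms of eigenmatrices: the eigenvalue
      \<open>P k i * P k j\<close> of the product on \<open>E k\<close>, times the entry of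
      \<open>E k\<close> on \<open>R h\<close>.\<close>
    define q where "q = (\<Sum>k\<le>d. P k i * P k j * (1 / real (card Y) * Q h k))"
    have "real (card {z \<in> Y. (x, z) \<in> R i \<and> (z, y) \<in> R j}) = q" if xy: "(x, y) \<in> R h" for x y
    proof -
      have "E k x y = 1 / real (card Y) * Q h k" if "k \<le> d" for k
      proof -
        have "(\<Sum>i\<le>d. Q i k * adjacency_matrix (R i) x y) = (\<Sum>i\<le>d. if i = h then Q i k else 0)"
          by (intro sum.cong) (simp_all add: adjacency_eq_delta[OF h _ xy])
        then show ?thesis using h by (simp add: E_eq[OF that])
      qed
      then show ?thesis
        unfolding card_eq_product[OF i j] adjacency_product[OF i j] q_def
        by (intro sum.cong) simp_all
    qed
    \<comment> \<open>\<open>q\<close> is a real number; rounding it yields one natural number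
      serving all pairs in \<open>R h\<close>. For an empty \<open>R h\<close> any value
      serves.\<close>
    then have "\<forall>(x, y)\<in>R h. card {z \<in> Y. (x, z) \<in> R i \<and> (z, y) \<in> R j} = nat \<lfloor>q\<rfloor>"
      by (metis (mono_tags, lifting) case_prodI2 floor_of_nat nat_int)
    then show ?thesis by blast
  qed
  then show ?thesis
    using finite nonempty R_0 R_cover R_disjoint R_sym by (auto simp: weak_association_scheme_def)
qed

section \<open>Primitive idempotents of the algebra\<close>

lemma E_in_algebra:
  assumes "j \<le> d"
  shows "E j \<in> bose_mesner_algebra d R"
  unfolding bose_mesner_algebra_def mem_Collect_eq
  by (rule exI[of _ "\<lambda>i. 1 / real (card Y) * Q i j"])
     (subst E_eq[OF assms], simp add: sum_distrib_left mult.assoc sum_divide_distrib)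

lemma algebra_combination:
  assumes "F \<in> bose_mesner_algebra d R"
  obtains c where "F = (\<lambda>x y. \<Sum>i\<le>d. c i * E i x y)"
proof -
  obtain a where a: "F = (\<lambda>x y. \<Sum>i\<le>d. a i * adjacency_matrix (R i) x y)"
    using assms by (auto simp: bose_mesner_algebra_def)
  have "F = (\<lambda>x y. \<Sum>i\<le>d. \<Sum>k\<le>d. a i * P k i * E k x y)"
    unfolding a by (intro ext sum.cong) (simp_all add: adjacency_eq sum_distrib_left mult.assoc)
  also have "\<dots> = (\<lambda>x y. \<Sum>k\<le>d. (\<Sum>i\<le>d. a i * P k i) * E k x y)"
    by (intro ext, subst sum.swap) (simp add: sum_distrib_right)
  finally show thesis by (rule that)
qed

text \<open>Multiplying \<open>F F = F\<close> by \<open>E j\<close> gives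
  \<open>c j * c j = c j\<close> at a nonzero entry of \<open>E j\<close>. For a zero
  \<open>E j\<close> the coefficient would be undetermined.\<close>

lemma idempotent_coefficient:
  assumes F: "F = (\<lambda>x y. \<Sum>i\<le>d. c i * E i x y)" and idem: "matrix_product Y F F = F"
    and j: "j \<le> d" "E j \<noteq> zero_matrix"
  shows "c j = 0 \<or> c j = 1"
proof -
  obtain x y where xy: "E j x y \<noteq> 0"
    using j(2) by (auto simp: zero_matrix_def fun_eq_iff)
  have FE: "matrix_product Y F (E j) = (\<lambda>x y. c j * E j x y)"
    using product_combination(1)[OF j(1)] F by simp
  have "matrix_product Y (matrix_product Y F F) (E j) = matrix_product Y F (matrix_product Y F (E j))"
    unfolding matrix_product_def
    by (intro ext, subst sum_distrib_left, subst sum_distrib_right, subst sum.swap)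
       (simp add: mult.assoc)
  also have "\<dots> = (\<lambda>x y. c j * matrix_product Y F (E j) x y)"
    by (subst FE) (simp add: matrix_product_def sum_distrib_left mult.left_commute)
  finally have "c j * E j x y = c j * (c j * E j x y)"
    unfolding idem FE by metis
  then show ?thesis using xy by simp
qed

text \<open>By \<open>idempotent_coefficient\<close>, an idempotent of the algebra is a sum of some
  of the nonzero \<open>E i\<close>, and it is primitive exactly when this sum has a single
  term.\<close>

lemma primitive_idempotents_eq:
  "primitive_idempotents Y (bose_mesner_algebra d R) = E ` {i. i \<le> d \<and> E i \<noteq> zero_matrix}"
proof (intro equalityI subsetI)
  fix F assume "F \<in> primitive_idempotents Y (bose_mesner_algebra d R)"
  then have F: "F \<in> bose_mesner_algebra d R" "F \<noteq> zero_matrix" "matrix_product Y F F = F"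
    and prim: "\<And>G. G \<in> bose_mesner_algebra d R \<Longrightarrow> matrix_product Y G G = G \<Longrightarrow>
      matrix_product Y F G = G \<Longrightarrow> matrix_product Y G F = G \<Longrightarrow> G = zero_matrix \<or> G = F"
    by (auto simp: primitive_idempotents_def)
  obtain c where c: "F = (\<lambda>x y. \<Sum>i\<le>d. c i * E i x y)"
    using algebra_combination[OF F(1)] .
  obtain j where j: "j \<le> d" "c j \<noteq> 0" "E j \<noteq> zero_matrix"
  proof (rule ccontr)
    assume "\<not> thesis"
    then have "\<And>i x y. i \<le> d \<Longrightarrow> c i * E i x y = 0"
      using that by (metis mult_eq_0_iff zero_matrix_def)
    then have "F = zero_matrix" unfolding c zero_matrix_def by (intro ext sum.neutral) auto
    then show False using F(2) by simp
  qed
  have "c j = 1" using idempotent_coefficient[OF c F(3) j(1,3)] j(2) by simp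
  \<comment> \<open>\<open>E j\<close> is a nonzero idempotent below \<open>F\<close>, so
    primitivity of \<open>F\<close> forces equality.\<close>
  then have "matrix_product Y F (E j) = E j" "matrix_product Y (E j) F = E j"
    using product_combination[OF j(1), of c] c by simp_all
  then have "E j = F"
    using prim[OF E_in_algebra[OF j(1)]] E_product[OF j(1) j(1)] j(3) by simp
  then show "F \<in> E ` {i. i \<le> d \<and> E i \<noteq> zero_matrix}" using j by blast
next
  fix F assume "F \<in> E ` {i. i \<le> d \<and> E i \<noteq> zero_matrix}"
  then obtain j where j: "j \<le> d" "E j \<noteq> zero_matrix" "F = E j" by blast
  have "G = zero_matrix \<or> G = E j"
    if G: "G \<in> bose_mesner_algebra d R" "matrix_product Y G G = G" "matrix_product Y (E j) G = G" for G
  proof -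
    obtain c where c: "G = (\<lambda>x y. \<Sum>i\<le>d. c i * E i x y)"
      using algebra_combination[OF G(1)] .
    have "G = (\<lambda>x y. c j * E j x y)"
      using product_combination(2)[OF j(1), of c] c G(3) by simp
    then show ?thesis
      using idempotent_coefficient[OF c G(2) j(1,2)] by (auto simp: zero_matrix_def)
  qed
  then show "F \<in> primitive_idempotents Y (bose_mesner_algebra d R)"
    using j E_in_algebra E_product[OF j(1) j(1)] by (simp add: primitive_idempotents_def)
qed

lemma weak_eigenmatrices: "weak_eigenmatrices Y d R P Q"
proof -
  \<comment> \<open>Equal nonzero idempotents with different indices would have product zero, yet be
    their own product.\<close>
  have "inj_on E {i. i \<le> d \<and> E i \<noteq> zero_matrix}"
    using E_product by (intro inj_onI) (metis (mono_tags, lifting) mem_Collect_eq)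
  then show ?thesis
    unfolding weak_eigenmatrices_def primitive_idempotents_eq
    using equations by (auto simp: bij_betw_def)
qed

lemma eigenmatrices:
  assumes "\<And>i. i \<le> d \<Longrightarrow> E i \<noteq> zero_matrix"
  shows "eigenmatrices Y d R P Q"
proof -
  have "{i. i \<le> d \<and> E i \<noteq> zero_matrix} = {..d}" using assms by auto
  moreover have "inj_on E {..d}"
    using E_product assms by (intro inj_onI) (metis (mono_tags, lifting) atMost_iff)
  ultimately show ?thesis
    unfolding eigenmatrices_def primitive_idempotents_eq
    using equations by (auto simp: bij_betw_def)
qed

text \<open>Since \<^term>\<open>E 0\<close> is the averaging matrix, its row of \<^term>\<open>P\<close> contains the valencies.\<close>

lemma relation_nonempty:
  assumes j: "j \<le> d" and P: "P 0 j \<noteq> 0"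
  shows "R j \<noteq> {}"
proof
  assume "R j = {}"
  then have "matrix_product Y (adjacency_matrix (R j)) (E 0) = zero_matrix"
    by (simp add: matrix_product_def adjacency_matrix_def zero_matrix_def)
  moreover have "matrix_product Y (adjacency_matrix (R j)) (E 0) = (\<lambda>x y. P 0 j * E 0 x y)"
    using product_combination(1)[of 0 "\<lambda>i. P i j"] adjacency_eq[OF j] by simp
  ultimately have "\<And>x y. P 0 j * E 0 x y = 0" by (metis zero_matrix_def)
  moreover obtain x where "x \<in> Y" using nonempty by blast
  moreover have "E 0 = (\<lambda>x y. of_bool (x \<in> Y \<and> y \<in> Y) / real (card Y))"
    using equations by (simp add: eigenmatrix_equations_def)
  ultimately show False using P finite by auto
qed

end

section \<open>Fourth moments\<close>

text \<open>Nesting vectors as entries of vectors puts tensors of any order into a Euclidean space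
  whose inner product factorises.\<close>

definition tensor :: "real ^ 'n \<Rightarrow> 'b::real_inner \<Rightarrow> 'b ^ 'n" where
  "tensor a t = (\<chi> i. (a $ i) *\<^sub>R t)"

lemma inner_tensor [simp]: "tensor a s \<bullet> tensor b t = (a \<bullet> b) * (s \<bullet> t)"
  by (simp add: tensor_def inner_vec_def sum_distrib_left mult_ac)

definition tensor4 :: "real ^ 'n \<Rightarrow> real ^ 'n \<Rightarrow> real ^ 'n \<Rightarrow> real ^ 'n \<Rightarrow> real ^ 'n ^ 'n ^ 'n ^ 'n" where
  "tensor4 a b c d = tensor a (tensor b (tensor c d))"

lemma inner_tensor4:
  "tensor4 a b c d \<bullet> tensor4 a' b' c' d' = (a \<bullet> a') * (b \<bullet> b') * (c \<bullet> c') * (d \<bullet> d')"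
  by (simp add: tensor4_def)

text \<open>The isotropic tensor dual to the fourth moment of the uniform measure on the sphere.\<close>

definition isotropic_tensor :: "real ^ 'n ^ 'n ^ 'n ^ 'n" where
  "isotropic_tensor = (\<Sum>e\<in>Basis. \<Sum>f\<in>Basis. tensor4 e e f f + tensor4 e f e f + tensor4 e f f e)"

text \<open>For each of the three pairings of the indices, the double sum splits into two Parseval
  sums.\<close>

lemma inner_isotropic_tensor:
  "tensor4 a b c d \<bullet> isotropic_tensor =
    (a \<bullet> b) * (c \<bullet> d) + (a \<bullet> c) * (b \<bullet> d) + (a \<bullet> d) * (b \<bullet> c)"
proof -
  have "(\<Sum>e\<in>Basis. \<Sum>f\<in>Basis. (p \<bullet> e) * (q \<bullet> e) * ((r \<bullet> f) * (s \<bullet> f))) = (p \<bullet> q) * (r \<bullet> s)"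
    for p q r s :: "real ^ 'n"
    by (simp add: euclidean_inner[of p q] euclidean_inner[of r s] sum_product)
  from this[of a b c d] this[of a c b d] this[of a d b c] show ?thesis
    by (simp add: isotropic_tensor_def inner_sum_right inner_add_right inner_tensor4
        sum.distrib mult_ac)
qed

lemma norm_isotropic_tensor:
  "(isotropic_tensor :: real ^ 'n ^ 'n ^ 'n ^ 'n) \<bullet> isotropic_tensor =
    3 * real CARD('n) * (real CARD('n) + 2)"
proof -
  let ?I = "isotropic_tensor :: real ^ 'n ^ 'n ^ 'n ^ 'n"
  have delta: "(\<Sum>f\<in>Basis. (e \<bullet> f) * (e \<bullet> f)) = 1" if "e \<in> Basis" for e :: "real ^ 'n"
    using that by (simp flip: euclidean_inner)
  have "?I \<bullet> ?I = (\<Sum>e\<in>Basis. \<Sum>f\<in>Basis.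
      (tensor4 e e f f + tensor4 e f e f + tensor4 e f f e) \<bullet> ?I)"
    by (subst isotropic_tensor_def) (simp add: inner_sum_left)
  \<comment> \<open>Each of the three pairings contributes
    \<open>1 + 2 * ((e \<bullet> f) * (e \<bullet> f))\<close>.\<close>
  also have "\<dots> = (\<Sum>e\<in>(Basis :: (real ^ 'n) set). \<Sum>f\<in>(Basis :: (real ^ 'n) set).
      3 + 6 * ((e \<bullet> f) * (e \<bullet> f)))"
    by (intro sum.cong refl) (simp add: inner_add_left inner_isotropic_tensor inner_commute[of f e for e f :: "real ^ 'n"])
  also have "\<dots> = (\<Sum>e\<in>(Basis :: (real ^ 'n) set). 3 * real CARD('n) + 6)"
    by (intro sum.cong refl) (simp add: sum.distrib delta flip: sum_distrib_left)
  finally show ?thesis by (simp add: algebra_simps)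
qed

text \<open>The energy hypothesis is the equality case of Cauchy-Schwarz for the moment tensor
  \<open>S\<close> and the isotropic tensor, so that \<open>S - k *\<^sub>R isotropic_tensor\<close>
  has norm zero. The value of \<open>k\<close> comes from comparing inner products with the
  isotropic tensor.\<close>

lemma fourth_moment:
  fixes M :: "(real ^ 'n) set"
  defines "k \<equiv> real (card M) / (real CARD('n) * (real CARD('n) + 2))"
  assumes unit: "\<And>x. x \<in> M \<Longrightarrow> x \<bullet> x = 1"
    and energy: "(\<Sum>x\<in>M. \<Sum>y\<in>M. (x \<bullet> y) ^ 4) = 3 * k * real (card M)"
  shows "(\<Sum>x\<in>M. (x \<bullet> a) * (x \<bullet> b) * (x \<bullet> c) * (x \<bullet> d)) =
    k * ((a \<bullet> b) * (c \<bullet> d) + (a \<bullet> c) * (b \<bullet> d) + (a \<bullet> d) * (b \<bullet> c))"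
proof -
  let ?I = "isotropic_tensor :: real ^ 'n ^ 'n ^ 'n ^ 'n"
  define S where "S = (\<Sum>x\<in>M. tensor4 x x x x)"
  have "S \<bullet> S = (\<Sum>x\<in>M. \<Sum>y\<in>M. (x \<bullet> y) ^ 4)"
    unfolding S_def by (subst inner_sum_left)
      (simp add: inner_sum_right inner_tensor4 power4_eq_xxxx)
  then have SS: "S \<bullet> S = 3 * k * real (card M)" using energy by simp
  have SI: "S \<bullet> ?I = 3 * real (card M)"
    by (simp add: S_def inner_sum_left inner_isotropic_tensor unit)
  have k: "k * (real CARD('n) * (real CARD('n) + 2)) = real (card M)"
    by (simp add: k_def)
  have "(S - k *\<^sub>R ?I) \<bullet> (S - k *\<^sub>R ?I) = S \<bullet> S - 2 * k * (S \<bullet> ?I) + k * k * (?I \<bullet> ?I)"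
    by (simp add: inner_diff_left inner_diff_right inner_commute algebra_simps)
  also have "\<dots> = 3 * k * (k * (real CARD('n) * (real CARD('n) + 2)) - real (card M))"
    unfolding SS SI norm_isotropic_tensor by (simp add: algebra_simps)
  finally have "S = k *\<^sub>R ?I" using k by simp
  then have "tensor4 a b c d \<bullet> S = k * (tensor4 a b c d \<bullet> ?I)" by simp
  then show ?thesis
    unfolding inner_isotropic_tensor
    by (simp add: S_def inner_sum_right inner_tensor4 inner_commute)
qed

section \<open>Tight frames made of regular simplices\<close>

lemma all_atMost_3: "(\<forall>i\<le>3::nat. P i) \<longleftrightarrow> P 0 \<and> P 1 \<and> P 2 \<and> P 3"
  by (auto simp: numeral_eq_Suc le_Suc_eq)

lemma sum_atMost_3: "(\<Sum>i\<le>3::nat. f i) = f 0 + f 1 + f 2 + (f 3 :: real)"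
  by (simp add: numeral_eq_Suc)

text \<open>The properties of \<open>Y\<close> that determine the scheme, detached from the bases.
  The frame constant is the size of \<open>Y\<close> divided by the dimension N - 2 of the space it
  is meant to span.\<close>

locale linked_simplices =
  fixes Y :: "'a::euclidean_space set" and N \<alpha> \<beta> \<gamma> :: real
    and R :: "nat \<Rightarrow> ('a \<times> 'a) set" and P Q :: "nat \<Rightarrow> nat \<Rightarrow> real"
  assumes N: "N > 2"
    and \<alpha>: "\<alpha> = (- sqrt N - 2) / (N - 2)"
    and \<beta>: "\<beta> = (sqrt N - 2) / (N - 2)"
    and \<gamma>: "\<gamma> = - 2 / (N - 2)"
    and R: "R = (\<lambda>i. [Id_on Y, inner_product_relation Y \<alpha>, inner_product_relation Y \<beta>,
                    inner_product_relation Y \<gamma>] ! i)"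
    and P: "P = (\<lambda>i j.
      [[1, (N - 2 * sqrt N) * (N - 2) / 8, (N + 2 * sqrt N) * (N - 2) / 8, N / 2 - 1],
       [1, - (sqrt N * (N - 4) / 8),       sqrt N * (N - 4) / 8,           - 1],
       [1, sqrt N / 2,                     - (sqrt N / 2),                 - 1],
       [1, - ((N - 2 * sqrt N) / 4),       - ((N + 2 * sqrt N) / 4),       N / 2 - 1]] ! i ! j)"
    and Q: "Q = (\<lambda>i j.
      [[1, N - 2,        (N - 2) * (N - 4) / 4, N / 2 - 1],
       [1, - sqrt N - 2, sqrt N + 2,            - 1],
       [1, sqrt N - 2,   - sqrt N + 2,          - 1],
       [1, - 2,          - (N / 2) + 2,         N / 2 - 1]] ! i ! j)"
    and card_Y: "real (card Y) = N\<^sup>2 / 4"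
    and unit: "\<And>x. x \<in> Y \<Longrightarrow> x \<bullet> x = 1"
    and three_distances: "\<And>x y. x \<in> Y \<Longrightarrow> y \<in> Y \<Longrightarrow> x \<noteq> y \<Longrightarrow> x \<bullet> y \<in> {\<alpha>, \<beta>, \<gamma>}"
    and fibre_trans: "\<And>x y z. x \<in> Y \<Longrightarrow> y \<in> Y \<Longrightarrow> z \<in> Y \<Longrightarrow> x \<bullet> y = \<gamma> \<Longrightarrow> y \<bullet> z = \<gamma> \<Longrightarrow>
      x \<noteq> z \<Longrightarrow> x \<bullet> z = \<gamma>"
    and card_fibre: "\<And>x. x \<in> Y \<Longrightarrow> real (card {z \<in> Y. x = z \<or> x \<bullet> z = \<gamma>}) = N / 2"
    and tight_frame: "\<And>x y. x \<in> Y \<Longrightarrow> y \<in> Y \<Longrightarrow>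
      (\<Sum>z\<in>Y. (x \<bullet> z) * (z \<bullet> y)) = N\<^sup>2 / (4 * (N - 2)) * (x \<bullet> y)"
begin

definition same_fibre :: "'a \<Rightarrow> 'a \<Rightarrow> bool" where
  "same_fibre x y \<longleftrightarrow> x \<in> Y \<and> y \<in> Y \<and> (x = y \<or> x \<bullet> y = \<gamma>)"

definition identity :: "'a matrix_on" where
  "identity x y = of_bool (x \<in> Y \<and> x = y)"

definition average :: "'a matrix_on" where
  "average x y = of_bool (x \<in> Y \<and> y \<in> Y) / real (card Y)"

text \<open>The factor is the reciprocal of the fibre size.\<close>

definition fibre_average :: "'a matrix_on" where
  "fibre_average x y = 2 / N * of_bool (same_fibre x y)"

text \<open>The factor is the reciprocal of the constant in \<open>tight_frame\<close>, which makes
  the Gram matrix idempotent.\<close>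

definition gram :: "'a matrix_on" where
  "gram x y = 4 * (N - 2) / N\<^sup>2 * (x \<bullet> y) * of_bool (x \<in> Y \<and> y \<in> Y)"

text \<open>In the order of the columns of \<open>Q\<close>: the projections onto the constants,
  onto the linear functions restricted to \<open>Y\<close>, onto what remains, and onto the
  fibrewise constant functions of mean zero.\<close>

definition E :: "nat \<Rightarrow> 'a matrix_on" where
  "E i = [average, gram, \<lambda>x y. identity x y - fibre_average x y - gram x y,
          \<lambda>x y. fibre_average x y - average x y] ! i"

section \<open>Fibres as regular simplices\<close>

lemma finite_Y: "finite Y" and Y_nonempty: "Y \<noteq> {}"
  using card_Y N by (auto intro: card_ge_0_finite intro!: Nat.gr0I)

lemma sqrt_N: "sqrt N * sqrt N = N" "sqrt N > 0" "sqrt N \<noteq> N"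
proof -
  show "sqrt N * sqrt N = N" "sqrt N > 0" using N by auto
  then show "sqrt N \<noteq> N" using N by (metis mult_cancel_left1 not_less_iff_gr_or_eq one_less_numeral_iff
        order_less_trans semiring_norm(76))
qed

lemma distances_distinct:
  "\<alpha> \<noteq> \<beta>" "\<alpha> \<noteq> \<gamma>" "\<beta> \<noteq> \<gamma>" "\<alpha> \<noteq> 1" "\<beta> \<noteq> 1" "\<gamma> \<noteq> 1"
  using N sqrt_N(2,3) by (auto simp: \<alpha> \<beta> \<gamma> divide_simps simp del: real_sqrt_gt_0_iff)

lemma same_fibre_sym: "same_fibre x y \<Longrightarrow> same_fibre y x"
  by (auto simp: same_fibre_def inner_commute)

lemma same_fibre_commute: "same_fibre x y = same_fibre y x"
  using same_fibre_sym by blast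

lemma same_fibre_trans: "same_fibre x y \<Longrightarrow> same_fibre y z \<Longrightarrow> same_fibre x z"
  unfolding same_fibre_def using fibre_trans by metis

lemma card_same_fibre: "x \<in> Y \<Longrightarrow> real (card {z. same_fibre x z}) = N / 2"
  using card_fibre[of x] by (simp add: same_fibre_def)

lemma sum_of_bool_fibre:
  "x \<in> Y \<Longrightarrow> (\<Sum>z\<in>Y. of_bool (same_fibre x z)) = N / 2"
  using card_same_fibre[of x] finite_Y
  by (simp add: sum.If_cases of_bool_def Int_def same_fibre_def)

text \<open>A fibre is a regular simplex, so the Gram matrix of its vectors has row sums zero.\<close>

lemma sum_fibre_eq_0:
  assumes "y \<in> Y"
  shows "(\<Sum>z | same_fibre y z. z) = 0"
proof -
  let ?C = "{z. same_fibre y z}"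
  have fin: "finite ?C" by (rule finite_subset[OF _ finite_Y]) (auto simp: same_fibre_def)
  have row: "(\<Sum>w\<in>?C. z \<bullet> w) = 0" if "z \<in> ?C" for z
  proof -
    have z: "z \<in> Y" using that by (simp add: same_fibre_def)
    have "(\<Sum>w\<in>?C. z \<bullet> w) = z \<bullet> z + (\<Sum>w\<in>?C - {z}. z \<bullet> w)"
      using that fin by (simp add: sum.remove)
    also have "(\<Sum>w\<in>?C - {z}. z \<bullet> w) = (\<Sum>w\<in>?C - {z}. \<gamma>)"
      using that same_fibre_trans[OF same_fibre_sym, of y z]
      by (intro sum.cong) (auto simp: same_fibre_def)
    also have "\<dots> = (N / 2 - 1) * \<gamma>"
    proof -
      have "card ?C \<noteq> 0" using that fin by auto
      then have "real (card (?C - {z})) = real (card ?C) - 1"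
        unfolding card_Diff_singleton[OF that] by (simp add: of_nat_diff Suc_leI)
      then show ?thesis using card_same_fibre[OF assms] by simp
    qed
    finally show ?thesis using N by (simp add: unit[OF z] \<gamma> field_simps)
  qed
  have "(\<Sum>z\<in>?C. z) \<bullet> (\<Sum>z\<in>?C. z) = (\<Sum>z\<in>?C. \<Sum>w\<in>?C. z \<bullet> w)"
    by (subst inner_sum_left) (simp add: inner_sum_right)
  also have "\<dots> = 0" using row by simp
  finally show ?thesis by simp
qed

lemma sum_inner_fibre:
  assumes "y \<in> Y"
  shows "(\<Sum>z\<in>Y. (x \<bullet> z) * of_bool (same_fibre y z)) = 0"
proof -
  have "(\<Sum>z\<in>Y. (x \<bullet> z) * of_bool (same_fibre y z)) = (\<Sum>z | same_fibre y z. x \<bullet> z)"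
    using finite_Y by (intro sum.mono_neutral_cong_right) (auto simp: same_fibre_def)
  also have "\<dots> = x \<bullet> (\<Sum>z | same_fibre y z. z)" by (simp add: inner_sum_right)
  finally show ?thesis by (simp add: sum_fibre_eq_0[OF assms])
qed

text \<open>Double counting: each \<open>z\<close> lies in the fibres of N/2 points
  \<open>y\<close>, and the sum over every single fibre is zero.\<close>

lemma sum_inner_Y: "(\<Sum>z\<in>Y. x \<bullet> z) = 0"
proof -
  have "N / 2 * (\<Sum>z\<in>Y. x \<bullet> z) = (\<Sum>z\<in>Y. (x \<bullet> z) * (\<Sum>y\<in>Y. of_bool (same_fibre z y)))"
    by (simp add: sum_of_bool_fibre sum_distrib_left mult.commute)
  also have "\<dots> = (\<Sum>y\<in>Y. \<Sum>z\<in>Y. (x \<bullet> z) * of_bool (same_fibre y z))"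
    unfolding sum_distrib_left
    by (subst sum.swap) (simp add: same_fibre_commute)
  also have "\<dots> = 0" by (simp add: sum_inner_fibre)
  finally show ?thesis using N by simp
qed

section \<open>Multiplication table of the projections\<close>

lemma identity_product:
  assumes "\<And>x y. x \<notin> Y \<or> y \<notin> Y \<Longrightarrow> A x y = 0"
  shows "matrix_product Y identity A = A" "matrix_product Y A identity = A"
proof -
  have "(\<Sum>z\<in>Y. identity x z * A z y) = (\<Sum>z\<in>Y. if z = x then A z y else 0)"
       "(\<Sum>z\<in>Y. A x z * identity z y) = (\<Sum>z\<in>Y. if z = y then A x z else 0)" for x y
    by (intro sum.cong; auto simp: identity_def)+
  then show "matrix_product Y identity A = A" "matrix_product Y A identity = A"
    using assms finite_Y by (auto simp: matrix_product_def fun_eq_iff)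
qed

lemma support:
  "x \<notin> Y \<or> y \<notin> Y \<Longrightarrow> average x y = 0"
  "x \<notin> Y \<or> y \<notin> Y \<Longrightarrow> fibre_average x y = 0"
  "x \<notin> Y \<or> y \<notin> Y \<Longrightarrow> gram x y = 0"
  "x \<notin> Y \<or> y \<notin> Y \<Longrightarrow> identity x y = 0"
  by (auto simp: average_def fibre_average_def gram_def identity_def same_fibre_def)

lemma identity_products:
  "matrix_product Y identity average = average" "matrix_product Y average identity = average"
  "matrix_product Y identity fibre_average = fibre_average"
  "matrix_product Y fibre_average identity = fibre_average"
  "matrix_product Y identity gram = gram" "matrix_product Y gram identity = gram"
  "matrix_product Y identity identity = identity"
  by (rule identity_product; erule support)+

lemma symmetric:
  "average x y = average y x" "fibre_average x y = fibre_average y x" "gram x y = gram y x"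
  using same_fibre_sym by (auto simp: average_def fibre_average_def gram_def inner_commute of_bool_def)

lemma matrix_product_symmetric:
  assumes "\<And>x y. A x y = A y x" "\<And>x y. B x y = B y x"
  shows "matrix_product Y A B x y = matrix_product Y B A y x"
  unfolding matrix_product_def using assms by (metis (no_types, lifting) mult.commute sum.cong)

text \<open>Averaging over fibres fixes constants, and \<open>gram\<close> annihilates everything
  constant on fibres because each fibre sums to zero. Idempotence of \<open>gram\<close> is the
  tight frame property.\<close>

lemma products:
  "matrix_product Y average average = average"
  "matrix_product Y fibre_average fibre_average = fibre_average"
  "matrix_product Y gram gram = gram"
  "matrix_product Y fibre_average average = average"
  "matrix_product Y average fibre_average = average"
  "matrix_product Y gram fibre_average = zero_matrix"
  "matrix_product Y fibre_average gram = zero_matrix"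
  "matrix_product Y gram average = zero_matrix"
  "matrix_product Y average gram = zero_matrix"
proof -
  have Y0: "real (card Y) \<noteq> 0" "N \<noteq> 0" using finite_Y Y_nonempty N by auto
  show "matrix_product Y average average = average"
    using Y0 by (auto simp: matrix_product_def average_def fun_eq_iff)
  show "matrix_product Y gram gram = gram"
  proof (intro ext)
    fix x y
    let ?k = "4 * (N - 2) / N\<^sup>2"
    show "matrix_product Y gram gram x y = gram x y"
    proof (cases "x \<in> Y \<and> y \<in> Y")
      case True
      have "matrix_product Y gram gram x y = ?k * ?k * (\<Sum>z\<in>Y. (x \<bullet> z) * (z \<bullet> y))"
        unfolding matrix_product_def sum_distrib_left
        using True by (intro sum.cong) (simp_all add: gram_def)
      also have "\<dots> = ?k * (x \<bullet> y)"
        using True N by (subst tight_frame) (simp_all add: field_simps)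
      finally show ?thesis using True by (simp add: gram_def)
    qed (auto simp: matrix_product_def gram_def)
  qed
  show "matrix_product Y fibre_average fibre_average = fibre_average"
  proof (intro ext)
    fix x y
    have "matrix_product Y fibre_average fibre_average x y =
        2 / N * (2 / N) * (\<Sum>z\<in>Y. of_bool (same_fibre x z) * of_bool (same_fibre z y))"
      unfolding matrix_product_def sum_distrib_left
      by (intro sum.cong) (simp_all add: fibre_average_def)
    also have "(\<Sum>z\<in>Y. of_bool (same_fibre x z) * of_bool (same_fibre z y)) =
        of_bool (same_fibre x y) * (\<Sum>z\<in>Y. of_bool (same_fibre x z) :: real)"
      unfolding sum_distrib_left
    proof (intro sum.cong refl)
      fix z
      \<comment> \<open>Fibres are equivalence classes, so \<open>z\<close> links \<open>x\<close>
        to \<open>y\<close> exactly when all three share a fibre.\<close>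
      have "same_fibre x z \<and> same_fibre z y \<longleftrightarrow> same_fibre x y \<and> same_fibre x z"
        using same_fibre_trans same_fibre_sym by blast
      then show "of_bool (same_fibre x z) * of_bool (same_fibre z y) =
          (of_bool (same_fibre x y) * of_bool (same_fibre x z) :: real)"
        by (cases "same_fibre x z") auto
    qed
    also have "2 / N * (2 / N) * \<dots> = fibre_average x y"
    proof (cases "x \<in> Y")
      case True
      then show ?thesis
        unfolding sum_of_bool_fibre[OF True] using Y0 by (simp add: fibre_average_def)
    qed (simp add: fibre_average_def same_fibre_def)
    finally show "matrix_product Y fibre_average fibre_average x y = fibre_average x y" .
  qed
  show fa: "matrix_product Y fibre_average average = average"
  proof (intro ext)
    fix x y
    have "matrix_product Y fibre_average average x y =
        of_bool (y \<in> Y) / real (card Y) * (2 / N) * (\<Sum>z\<in>Y. of_bool (same_fibre x z))"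
      unfolding matrix_product_def sum_distrib_left
      by (intro sum.cong) (simp_all add: fibre_average_def average_def)
    also have "\<dots> = average x y"
    proof (cases "x \<in> Y")
      case True
      then show ?thesis unfolding sum_of_bool_fibre[OF True] using Y0 by (simp add: average_def)
    qed (simp add: average_def same_fibre_def)
    finally show "matrix_product Y fibre_average average x y = average x y" .
  qed
  show gf: "matrix_product Y gram fibre_average = zero_matrix"
  proof (intro ext)
    fix x y
    have "matrix_product Y gram fibre_average x y = 4 * (N - 2) / N\<^sup>2 * of_bool (x \<in> Y) * (2 / N) *
        (\<Sum>z\<in>Y. (x \<bullet> z) * of_bool (same_fibre y z))"
      unfolding matrix_product_def sum_distrib_left symmetric(2)[of _ y]
      by (intro sum.cong) (simp_all add: fibre_average_def gram_def)
    then show "matrix_product Y gram fibre_average x y = zero_matrix x y"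
      using sum_inner_fibre[of y x] by (cases "y \<in> Y") (simp_all add: zero_matrix_def same_fibre_def)
  qed
  show ga: "matrix_product Y gram average = zero_matrix"
  proof (intro ext)
    fix x y
    have "matrix_product Y gram average x y = 4 * (N - 2) / N\<^sup>2 * of_bool (x \<in> Y) *
        (of_bool (y \<in> Y) / real (card Y)) * (\<Sum>z\<in>Y. x \<bullet> z)"
      unfolding matrix_product_def sum_distrib_left
      by (intro sum.cong) (simp_all add: average_def gram_def)
    then show "matrix_product Y gram average x y = zero_matrix x y"
      by (simp add: sum_inner_Y zero_matrix_def)
  qed
  \<comment> \<open>The remaining three products are transposes of products already
    computed.\<close>
  show "matrix_product Y average fibre_average = average"
    using matrix_product_symmetric[OF symmetric(1,2)] symmetric(1) by (simp add: fa fun_eq_iff)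
  show "matrix_product Y fibre_average gram = zero_matrix"
    using matrix_product_symmetric[OF symmetric(2,3)] by (simp add: gf fun_eq_iff zero_matrix_def)
  show "matrix_product Y average gram = zero_matrix"
    using matrix_product_symmetric[OF symmetric(1,3)] by (simp add: ga fun_eq_iff zero_matrix_def)
qed

text \<open>The range of \<open>average\<close> lies in that of \<open>fibre_average\<close>, which
  is orthogonal to that of \<open>gram\<close>; hence the differences are again idempotent and
  mutually orthogonal.\<close>

lemma E_product:
  assumes "i \<le> 3" "j \<le> 3"
  shows "matrix_product Y (E i) (E j) = (if i = j then E i else zero_matrix)"
proof -
  have "\<forall>i\<le>3. \<forall>j\<le>3. matrix_product Y (E i) (E j) = (if i = j then E i else zero_matrix)"
    unfolding all_atMost_3
    by (simp add: E_def matrix_product_diff_left matrix_product_diff_right products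
        identity_products) (simp add: zero_matrix_def fun_eq_iff)
  then show ?thesis using assms by blast
qed

section \<open>Relations and eigenmatrix equations\<close>

lemma R_simps: "R 0 = Id_on Y" "R (Suc 0) = inner_product_relation Y \<alpha>" "R 1 = inner_product_relation Y \<alpha>"
  "R 2 = inner_product_relation Y \<beta>" "R 3 = inner_product_relation Y \<gamma>"
  by (simp_all add: R numeral_eq_Suc)

lemma R_cover: "(\<Union>i\<le>3. R i) = Y \<times> Y"
proof
  show "(\<Union>i\<le>3. R i) \<subseteq> Y \<times> Y"
    by (auto simp: numeral_eq_Suc le_Suc_eq R inner_product_relation_def)
  show "Y \<times> Y \<subseteq> (\<Union>i\<le>3. R i)"
  proof clarify
    fix x y assume "x \<in> Y" "y \<in> Y"
    then have "\<not> (\<forall>i\<le>3. (x, y) \<notin> R i)"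
      using three_distances[of x y] unfolding all_atMost_3 R_simps by (auto simp: inner_product_relation_def)
    then show "(x, y) \<in> (\<Union>i\<le>3. R i)" by auto
  qed
qed

lemma R_disjoint:
  assumes "i \<le> 3" "j \<le> 3" "i \<noteq> j"
  shows "R i \<inter> R j = {}"
proof -
  have "\<forall>i\<le>3. \<forall>j\<le>3. i \<noteq> j \<longrightarrow> R i \<inter> R j = {}"
    unfolding all_atMost_3 R_simps
    using distances_distinct unit by (auto simp: inner_product_relation_def)
  then show ?thesis using assms by blast
qed

text \<open>\<open>Q\<close> and \<open>P\<close> are inverse up to the factor
  \<open>card Y\<close>. This inverts the expansion of the idempotents in adjacency
  matrices.\<close>

lemma QP:
  assumes "h \<le> 3" "j \<le> 3"
  shows "(\<Sum>i\<le>3. Q h i * P i j) = N\<^sup>2 / 4 * of_bool (h = j)"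
proof -
  \<comment> \<open>Substituting \<open>s * s\<close> for N makes every matrix entry a polynomial in
    \<open>s\<close>, which leaves polynomial identities.\<close>
  define s where "s = sqrt N"
  have s: "N = s * s" using sqrt_N by (simp add: s_def)
  have "\<forall>h\<le>3. \<forall>j\<le>3. (\<Sum>i\<le>3. Q h i * P i j) = N\<^sup>2 / 4 * of_bool (h = j)"
    unfolding all_atMost_3 sum_atMost_3 P Q s_def[symmetric]
    by (simp add: numeral_eq_Suc[of "Num.Bit1 Num.One"] numeral_eq_Suc[of "Num.Bit0 Num.One"])
       (simp add: s field_simps power2_eq_square)
  then show ?thesis using assms by blast
qed

text \<open>Identity, fibre membership and inner product depend only on the relation containing the
  pair, so the entries of \<open>Q\<close> can be read off case by case.\<close>

lemma E_value:
  assumes "h \<le> 3" "j \<le> 3" "(x, y) \<in> R h"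
  shows "E j x y = Q h j / real (card Y)"
proof -
  have N0: "N \<noteq> 0" "N - 2 \<noteq> 0" using N by auto
  \<comment> \<open>The definitions of \<alpha>, \<beta>, \<gamma> with denominators cleared,
    oriented to eliminate products with N.\<close>
  have scaled: "N * (\<alpha> * 4) = \<alpha> * 8 - sqrt N * 4 - 8" "N * (\<beta> * 4) = \<beta> * 8 + sqrt N * 4 - 8"
    "N * (\<gamma> * 4) = \<gamma> * 8 - 8"
    using N0 by (simp_all add: \<alpha> \<beta> \<gamma> field_simps)
  have "\<forall>h\<le>3. (x, y) \<in> R h \<longrightarrow> (\<forall>j\<le>3. E j x y = Q h j / real (card Y))"
    unfolding all_atMost_3 R_simps E_def Q card_Y
    using N0 distances_distinct
    by (simp add: inner_product_relation_def average_def gram_def fibre_average_def identity_def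
        same_fibre_def card_Y unit Id_on_iff)
       (intro conjI impI; (elim conjE)?; simp?;
        (simp add: unit field_simps power2_eq_square)?; simp add: scaled algebra_simps)
  then show ?thesis using assms by blast
qed

text \<open>All matrices vanish off \<open>Y \<times> Y\<close>. A pair inside lies in exactly one
  \<open>R h\<close>, where \<open>E_value\<close> reduces the expansion of the adjacency matrices
  to \<open>QP\<close>.\<close>

lemma equations: "eigenmatrix_equations Y 3 R E P Q"
proof -
  have E0: "E 0 = (\<lambda>x y. of_bool (x \<in> Y \<and> y \<in> Y) / real (card Y))"
    by (simp add: E_def average_def fun_eq_iff)
  have "adjacency_matrix (R j) x y = (\<Sum>i\<le>3. P i j * E i x y)
      \<and> E j x y = 1 / real (card Y) * (\<Sum>i\<le>3. Q i j * adjacency_matrix (R i) x y)"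
    if j: "j \<le> 3" for j x y
  proof (cases "x \<in> Y \<and> y \<in> Y")
    case False
    then have "adjacency_matrix (R i) x y = 0" "E i x y = 0" if "i \<le> 3" for i
      using that by (auto simp: numeral_eq_Suc le_Suc_eq adjacency_matrix_def R inner_product_relation_def
          E_def support)
    then show ?thesis using j by simp
  next
    case True
    then obtain h where h: "h \<le> 3" "(x, y) \<in> R h" using R_cover by blast
    have adj: "adjacency_matrix (R i) x y = of_bool (h = i)" if "i \<le> 3" for i
      using that h R_disjoint[of i h] by (auto simp: adjacency_matrix_def)
    have "(\<Sum>i\<le>3. P i j * E i x y) = (\<Sum>i\<le>3. Q h i * P i j) / real (card Y)"
      unfolding sum_divide_distrib by (intro sum.cong) (simp_all add: E_value[OF h(1) _ h(2)])
    also have "\<dots> = of_bool (h = j)"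
      unfolding QP[OF h(1) j] card_Y using N by simp
    finally have "adjacency_matrix (R j) x y = (\<Sum>i\<le>3. P i j * E i x y)"
      using adj[OF j] by simp
    moreover have "(\<Sum>i\<le>3. Q i j * adjacency_matrix (R i) x y) = (\<Sum>i\<le>3. if h = i then Q i j else 0)"
      by (intro sum.cong) (simp_all add: adj)
    ultimately show ?thesis
      using h(1) E_value[OF h(1) j h(2)] by simp
  qed
  then show ?thesis
    unfolding eigenmatrix_equations_def using E0 by (simp add: fun_eq_iff)
qed

sublocale orthogonal_idempotents Y 3 R E P Q
proof
  have "\<forall>i\<le>3. sym (R i)"
    unfolding all_atMost_3 R_simps by (auto simp: inner_product_relation_def sym_def inner_commute)
  then show "sym (R i)" if "i \<le> 3" for i
    using that by blast
qed (simp_all add: finite_Y Y_nonempty R_simps(1) R_cover R_disjoint E_product equations)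

text \<open>For N > 2, the valency \<open>P 0 1\<close> and the multiplicity \<open>Q 0 2\<close>
  vanish only at N = 4. Otherwise all valencies are nonzero, and so is the diagonal of each
  \<open>E j\<close>, which is \<open>Q 0 j / card Y\<close>.\<close>

lemma association_scheme_and_eigenmatrices:
  assumes "N \<noteq> 4"
  shows "association_scheme Y 3 R \<and> eigenmatrices Y 3 R P Q"
proof
  have "N - 2 * sqrt N \<noteq> 0"
  proof
    assume "N - 2 * sqrt N = 0"
    then have "sqrt N * (sqrt N - 2) = 0" using sqrt_N by (simp add: algebra_simps)
    then have "sqrt N = 2" using sqrt_N by simp
    then show False using sqrt_N assms by simp
  qed
  moreover have "N + 2 * sqrt N \<noteq> 0" using N sqrt_N by (smt (verit))
  ultimately have "\<forall>j\<le>3. P 0 j \<noteq> 0"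
    unfolding all_atMost_3 using N by (simp add: P)
  then show "association_scheme Y 3 R"
    using weak_association_scheme relation_nonempty by (simp add: association_scheme_def)
  obtain x where x: "x \<in> Y" using Y_nonempty by blast
  have diag: "E j x x = Q 0 j / real (card Y)" if "j \<le> 3" for j
    using x by (intro E_value that) (simp_all add: R_simps(1) Id_on_iff)
  have "\<forall>j\<le>3. Q 0 j \<noteq> 0"
    unfolding all_atMost_3 using N assms by (simp add: Q)
  then have "\<forall>j\<le>3. E j x x \<noteq> 0" using diag finite_Y Y_nonempty by simp
  then show "eigenmatrices Y 3 R P Q"
    by (intro eigenmatrices) (auto simp: zero_matrix_def)
qed

end

section \<open>Mutually unbiased bases\<close>

lemma orthonormal_basis_finite_card:
  fixes B :: "'a::euclidean_space set"
  assumes "orthonormal_basis B"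
  shows "finite B" "card B = DIM('a)"
proof -
  have "0 \<notin> B" "pairwise orthogonal B" "span B = UNIV"
    using assms by (auto simp: orthonormal_basis_def)
  then have "independent B" by (simp add: pairwise_orthogonal_independent)
  then show "finite B" "card B = DIM('a)"
    using \<open>span B = UNIV\<close> by (simp_all add: independent_imp_finite dim_span dim_UNIV
        flip: dim_eq_card_independent dim_span[of B])
qed

lemma orthonormal_basis_inner:
  assumes "orthonormal_basis B" "x \<in> B" "y \<in> B"
  shows "x \<bullet> y = of_bool (x = y)"
  using assms by (auto simp: orthonormal_basis_def pairwise_def orthogonal_def norm_eq_1)

lemma orthonormal_basis_parseval:
  assumes "orthonormal_basis B"
  shows "(\<Sum>b\<in>B. (x \<bullet> b) * (y \<bullet> b)) = x \<bullet> y"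
proof -
  have "(\<Sum>b\<in>B. (x \<bullet> b) *\<^sub>R b) = x"
    using assms orthonormal_basis_finite_card[OF assms]
    by (intro orthonormal_basis_expand) (auto simp: orthonormal_basis_def)
  then have "x \<bullet> y = (\<Sum>b\<in>B. (x \<bullet> b) *\<^sub>R b) \<bullet> y" by simp
  then show ?thesis by (simp add: inner_sum_left inner_commute[of y])
qed

lemma orthogonal_projection_orthogonal_comp_span:
  fixes u v x :: "'a::euclidean_space"
  assumes "u \<bullet> u = 1" "v \<bullet> v = 1" "u \<bullet> v = 0"
  shows "orthogonal_projection ((span {u, v})\<^sup>\<bottom>) x = x - ((u \<bullet> x) *\<^sub>R u + (v \<bullet> x) *\<^sub>R v)"
proof -
  have comp: "y \<in> (span {u, v})\<^sup>\<bottom> \<longleftrightarrow> u \<bullet> y = 0 \<and> v \<bullet> y = 0" for y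
  proof
    assume "y \<in> (span {u, v})\<^sup>\<bottom>"
    then show "u \<bullet> y = 0 \<and> v \<bullet> y = 0"
      by (simp add: orthogonal_comp_def orthogonal_def span_base)
  next
    assume uv: "u \<bullet> y = 0 \<and> v \<bullet> y = 0"
    have "z \<bullet> y = 0" if "z \<in> span {u, v}" for z
      using that
    proof (induction rule: span_induct_alt)
      case (step c b z)
      then show ?case using uv by (auto simp: inner_add_left)
    qed simp
    then show "y \<in> (span {u, v})\<^sup>\<bottom>" by (simp add: orthogonal_comp_def orthogonal_def)
  qed
  let ?q = "(u \<bullet> x) *\<^sub>R u + (v \<bullet> x) *\<^sub>R v"
  have vu: "v \<bullet> u = 0" using assms(3) by (simp add: inner_commute)
  have q: "?q \<in> span {u, v}"
    by (intro span_add span_scale span_base) auto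
  show ?thesis
    unfolding orthogonal_projection_def
  proof (rule the_equality)
    have "?q \<in> ((span {u, v})\<^sup>\<bottom>)\<^sup>\<bottom>"
      using q by (auto simp: orthogonal_comp_def orthogonal_commute)
    then show "x - ?q \<in> (span {u, v})\<^sup>\<bottom> \<and> x - (x - ?q) \<in> ((span {u, v})\<^sup>\<bottom>)\<^sup>\<bottom>"
      using assms vu comp[of "x - ?q"] by (simp add: inner_diff_right inner_add_right add.commute)
  next
    fix p assume p: "p \<in> (span {u, v})\<^sup>\<bottom> \<and> x - p \<in> ((span {u, v})\<^sup>\<bottom>)\<^sup>\<bottom>"
    \<comment> \<open>Uniqueness: the difference \<open>d\<close> of two candidates is orthogonal to
      \<open>u\<close> and \<open>v\<close>, hence to both \<open>?q\<close> and
      \<open>x - p\<close>, and therefore to itself.\<close>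
    define d where "d = p - (x - ?q)"
    have d: "u \<bullet> d = 0" "v \<bullet> d = 0"
      using p assms vu unfolding comp d_def by (simp_all add: inner_diff_right inner_add_right)
    have "d \<bullet> (x - p) = 0"
      using p d comp[of d] by (auto simp: orthogonal_comp_def orthogonal_def)
    moreover have "d \<bullet> ?q = 0"
      using d by (simp add: inner_add_right inner_commute)
    moreover have "d = ?q - (x - p)" by (simp add: d_def)
    ultimately have "d \<bullet> d = 0" by (metis diff_zero inner_diff_right)
    then show "p = x - ?q" by (simp add: d_def)
  qed
qed

text \<open>\<open>B0\<close> is singled out because it is the one basis that contributes nothing to
  \<open>Y'\<close>.\<close>

locale mub_orthogonal_pair =
  fixes \<B> :: "(real ^ 'n) set set" and B0 M X Y' :: "(real ^ 'n) set"
    and u v :: "real ^ 'n" and N :: real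
  assumes N: "N = real CARD('n)" and N_gt: "N > 2"
    and maximal: "maximal_mub_collection \<B>"
    and M: "M = \<Union>\<B>"
    and X: "X = M \<union> uminus ` M"
    and B0: "B0 \<in> \<B>" "u \<in> B0 \<union> uminus ` B0" "v \<in> B0 \<union> uminus ` B0"
    and uv: "u \<bullet> v = 0"
    and Y': "Y' = {x \<in> X. u \<bullet> x = 1 / sqrt N \<and> v \<bullet> x = 1 / sqrt N}"
begin

section \<open>Fourth moments of the maximal collection\<close>

lemma basis: "B \<in> \<B> \<Longrightarrow> orthonormal_basis B"
  using maximal by (simp add: maximal_mub_collection_def)

lemma unbiased:
  "B \<in> \<B> \<Longrightarrow> B' \<in> \<B> \<Longrightarrow> B \<noteq> B' \<Longrightarrow> x \<in> B \<Longrightarrow> y \<in> B' \<Longrightarrow> \<bar>x \<bullet> y\<bar> = 1 / sqrt N"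
  using maximal by (auto simp: maximal_mub_collection_def pairwise_def mutually_unbiased_def N)

lemma card_bases: "real (card \<B>) = N / 2 + 1"
  using maximal by (simp add: maximal_mub_collection_def N)

lemma finite_bases: "finite \<B>"
  using card_bases N_gt by (intro card_ge_0_finite) linarith

lemma card_other_bases: "B \<in> \<B> \<Longrightarrow> real (card (\<B> - {B})) = N / 2"
proof -
  assume B: "B \<in> \<B>"
  then have "card \<B> = Suc (card (\<B> - {B}))" using finite_bases by (metis card.remove)
  then show ?thesis using card_bases by simp
qed

lemma finite_basis: "B \<in> \<B> \<Longrightarrow> finite B" and card_basis: "B \<in> \<B> \<Longrightarrow> real (card B) = N"
  using orthonormal_basis_finite_card[OF basis] by (simp_all add: N)

lemma sqrt_N: "sqrt N * sqrt N = N" "1 / sqrt N > 0" "1 / sqrt N \<noteq> 1"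
  using N_gt by auto

lemma inner_squared: "\<bar>t\<bar> = 1 / sqrt N \<Longrightarrow> t * t = 1 / N"
proof -
  assume "\<bar>t\<bar> = 1 / sqrt N"
  then have "\<bar>t\<bar> * \<bar>t\<bar> = 1 / (sqrt N * sqrt N)" by simp
  then show ?thesis using sqrt_N(1) by simp
qed

lemma bases_disjoint: "B \<in> \<B> \<Longrightarrow> B' \<in> \<B> \<Longrightarrow> B \<noteq> B' \<Longrightarrow> B \<inter> B' = {}"
proof (rule ccontr)
  assume *: "B \<in> \<B>" "B' \<in> \<B>" "B \<noteq> B'" "B \<inter> B' \<noteq> {}"
  then obtain x where "x \<in> B" "x \<in> B'" by blast
  then show False
    using unbiased[OF *(1-3), of x x] orthonormal_basis_inner[OF basis[OF *(1)], of x x] sqrt_N by simp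
qed

lemma sum_M: "(\<Sum>x\<in>M. f x) = (\<Sum>B\<in>\<B>. \<Sum>x\<in>B. f x)"
  unfolding M using finite_basis bases_disjoint by (subst sum.Union_disjoint) auto

lemma M_unit: "x \<in> M \<Longrightarrow> x \<bullet> x = 1"
  using orthonormal_basis_inner[OF basis] by (auto simp: M)

lemma card_M: "real (card M) = N * (N / 2 + 1)"
  using sum_M[of "\<lambda>_. 1 :: real"] card_basis card_bases by simp

text \<open>The basis of \<open>x\<close> contributes 1; each of the N/2 other bases contributes N
  terms equal to \<open>1 / N\<^sup>2\<close>.\<close>

lemma fourth_power_sum:
  assumes "x \<in> M"
  shows "(\<Sum>y\<in>M. (x \<bullet> y) ^ 4) = 3 / 2"
proof -
  obtain B where B: "B \<in> \<B>" "x \<in> B" using assms by (auto simp: M)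
  have "(\<Sum>y\<in>B. (x \<bullet> y) ^ 4) = (\<Sum>y\<in>B. if x = y then 1 else 0)"
    using orthonormal_basis_inner[OF basis[OF B(1)] B(2)] by (intro sum.cong) auto
  also have "\<dots> = 1" using B finite_basis by simp
  finally have one: "(\<Sum>y\<in>B. (x \<bullet> y) ^ 4) = 1" .
  have "(\<Sum>y\<in>B'. (x \<bullet> y) ^ 4) = 1 / N" if "B' \<in> \<B> - {B}" for B'
  proof -
    have "(x \<bullet> y) ^ 4 = 1 / N * (1 / N)" if "y \<in> B'" for y
      using inner_squared[OF unbiased[OF B(1) _ _ B(2) that]] \<open>B' \<in> \<B> - {B}\<close>
      by (metis Diff_iff insert_iff mult.assoc power4_eq_xxxx)
    then show ?thesis using card_basis[of B'] that N_gt by simp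
  qed
  then have "(\<Sum>B'\<in>\<B> - {B}. \<Sum>y\<in>B'. (x \<bullet> y) ^ 4) = N / 2 * (1 / N)"
    using card_other_bases[OF B(1)] by simp
  then show ?thesis
    using one N_gt by (simp add: sum_M sum.remove[OF finite_bases B(1)])
qed

text \<open>Here \<open>k\<close> is 1/2, since \<open>M\<close> has N(N + 2)/2 elements, and the
  energy per vector is 3/2 = 3k as required.\<close>

lemma M_fourth_moment:
  "(\<Sum>x\<in>M. (x \<bullet> a) * (x \<bullet> b) * (x \<bullet> c) * (x \<bullet> d)) =
    1 / 2 * ((a \<bullet> b) * (c \<bullet> d) + (a \<bullet> c) * (b \<bullet> d) + (a \<bullet> d) * (b \<bullet> c))"
proof -
  have k: "real (card M) / (real CARD('n) * (real CARD('n) + 2)) = 1 / 2"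
  proof -
    have "N * (N + 2) \<noteq> 0" using N_gt by simp
    then show ?thesis unfolding card_M N[symmetric] by (simp add: field_simps)
  qed
  show ?thesis
    using fourth_moment[of M a b c d] M_unit fourth_power_sum unfolding k by simp
qed

section \<open>The fibres of \<open>Y'\<close> over the bases\<close>

lemma u_v_unit: "u \<bullet> u = 1" "v \<bullet> v = 1"
  using B0 orthonormal_basis_inner[OF basis[OF B0(1)]] by auto

text \<open>Up to sign, \<open>u\<close> and \<open>v\<close> are distinct elements of
  \<open>B0\<close>, so \<open>b\<close> is orthogonal to at least one of them.\<close>

lemma inner_B0: "b \<in> B0 \<Longrightarrow> (u \<bullet> b) * (v \<bullet> b) = 0"
  using B0(2,3) uv by (auto simp: orthonormal_basis_inner[OF basis[OF B0(1)]])

lemma inner_other_basis: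
  assumes "B \<in> \<B> - {B0}" "b \<in> B"
  shows "\<bar>u \<bullet> b\<bar> = 1 / sqrt N" "\<bar>v \<bullet> b\<bar> = 1 / sqrt N"
proof -
  have "\<bar>x \<bullet> b\<bar> = 1 / sqrt N" if "x \<in> B0 \<union> uminus ` B0" for x
    using that unbiased[OF B0(1), of B _ b] assms by fastforce
  then show "\<bar>u \<bullet> b\<bar> = 1 / sqrt N" "\<bar>v \<bullet> b\<bar> = 1 / sqrt N" using B0 by simp_all
qed

definition fibre :: "(real ^ 'n) set \<Rightarrow> (real ^ 'n) set" where
  "fibre B = {x \<in> Y'. x \<in> B \<or> - x \<in> B}"

lemma mem_Y': "x \<in> Y' \<longleftrightarrow> x \<in> X \<and> u \<bullet> x = 1 / sqrt N \<and> v \<bullet> x = 1 / sqrt N"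
  by (simp add: Y')

lemma inner_Y': "x \<in> Y' \<Longrightarrow> u \<bullet> x = 1 / sqrt N" "x \<in> Y' \<Longrightarrow> v \<bullet> x = 1 / sqrt N"
  by (simp_all add: Y')

text \<open>\<open>B0\<close> is excluded because points of \<open>Y'\<close> are orthogonal to
  neither \<open>u\<close> nor \<open>v\<close>.\<close>

lemma Y'_fibre:
  assumes "x \<in> Y'"
  obtains B where "B \<in> \<B> - {B0}" "x \<in> fibre B"
proof -
  have "x \<in> X" using assms by (simp add: Y')
  then obtain B where B: "B \<in> \<B>" "x \<in> B \<or> - x \<in> B" by (auto simp: X M)
  have "(u \<bullet> x) * (v \<bullet> x) \<noteq> 0" using inner_Y'[OF assms] sqrt_N by simp
  then have "B \<noteq> B0" using inner_B0[of x] inner_B0[of "- x"] B by auto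
  then show thesis using B assms that by (auto simp: fibre_def)
qed

lemma inner_same_fibre:
  assumes B: "B \<in> \<B>" and "x \<in> fibre B" "y \<in> fibre B"
  shows "x \<bullet> y = of_bool (x = y)"
proof -
  \<comment> \<open>Antipodal points cannot both lie in \<open>Y'\<close>, where the inner product
    with \<open>u\<close> is positive.\<close>
  have *: "x \<noteq> - y" "- x \<noteq> y"
    using inner_Y'[of x] inner_Y'[of y] assms sqrt_N by (auto simp: fibre_def)
  show ?thesis
    using assms(2,3) * orthonormal_basis_inner[OF basis[OF B], of x y]
      orthonormal_basis_inner[OF basis[OF B], of "- x" y]
      orthonormal_basis_inner[OF basis[OF B], of x "- y"]
      orthonormal_basis_inner[OF basis[OF B], of "- x" "- y"]
    by (auto simp: fibre_def)
qed

lemma inner_different_fibres: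
  assumes "B \<in> \<B>" "B' \<in> \<B>" "B \<noteq> B'" "x \<in> fibre B" "y \<in> fibre B'"
  shows "\<bar>x \<bullet> y\<bar> = 1 / sqrt N"
  using assms(4,5) unbiased[OF assms(1-3), of x y] unbiased[OF assms(1-3), of "- x" y]
    unbiased[OF assms(1-3), of x "- y"] unbiased[OF assms(1-3), of "- x" "- y"]
  by (auto simp: fibre_def)

lemma fibres_disjoint: "B \<in> \<B> \<Longrightarrow> B' \<in> \<B> \<Longrightarrow> B \<noteq> B' \<Longrightarrow> fibre B \<inter> fibre B' = {}"
proof (rule ccontr)
  assume *: "B \<in> \<B>" "B' \<in> \<B>" "B \<noteq> B'" "fibre B \<inter> fibre B' \<noteq> {}"
  then obtain x where "x \<in> fibre B" "x \<in> fibre B'" by blast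
  then show False
    using inner_different_fibres[OF *(1-3), of x x] inner_same_fibre[OF *(1), of x x] sqrt_N by simp
qed

lemma finite_fibre: "B \<in> \<B> \<Longrightarrow> finite (fibre B)"
  by (rule finite_subset[of _ "B \<union> uminus ` B"])
     (auto simp: fibre_def finite_basis intro: rev_image_eqI)

lemma sum_Y': "(\<Sum>x\<in>Y'. f x) = (\<Sum>B\<in>\<B> - {B0}. \<Sum>x\<in>fibre B. f x)"
proof -
  have "Y' = (\<Union>B\<in>\<B> - {B0}. fibre B)"
  proof (intro equalityI subsetI)
    fix x assume "x \<in> Y'"
    then show "x \<in> (\<Union>B\<in>\<B> - {B0}. fibre B)" by (rule Y'_fibre) blast
  qed (auto simp: fibre_def)
  then have "(\<Sum>x\<in>Y'. f x) = (\<Sum>x\<in>(\<Union>B\<in>\<B> - {B0}. fibre B). f x)" by (rule arg_cong)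
  also have "\<dots> = (\<Sum>B\<in>\<B> - {B0}. \<Sum>x\<in>fibre B. f x)"
    using finite_fibre fibres_disjoint finite_bases by (intro sum.UNION_disjoint) auto
  finally show ?thesis .
qed

text \<open>Up to sign, the fibre over a basis consists of the \<open>b\<close> with \<open>(u \<bullet> b) * (v \<bullet> b) = 1 / N\<close>;
  the other half of the basis has \<open>(u \<bullet> b) * (v \<bullet> b) = - 1 / N\<close>.\<close>

lemma sum_fibre:
  fixes f :: "real ^ 'n \<Rightarrow> real"
  assumes B: "B \<in> \<B> - {B0}" and even: "\<And>x. f (- x) = f x"
  shows "(\<Sum>x\<in>fibre B. f x) = (\<Sum>b\<in>B. (1 + N * ((u \<bullet> b) * (v \<bullet> b))) / 2 * f b)"
proof -
  have BB: "B \<in> \<B>" using B by simp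
  \<comment> \<open>At most one of \<open>b\<close> and \<open>- b\<close> is in the basis, so a
    fibre point determines its basis vector.\<close>
  have neg: "- b \<notin> B" if "b \<in> B" for b
  proof
    assume "- b \<in> B"
    then have "b \<bullet> - b = of_bool (b = - b)"
      using orthonormal_basis_inner[OF basis[OF BB]] that by blast
    moreover have "b \<bullet> b = 1" using that BB by (intro M_unit) (auto simp: M)
    moreover have "(0::real) \<le> of_bool (b = - b)" by simp
    ultimately have "(0::real) \<le> - 1" by (metis inner_minus_right)
    then show False by simp
  qed
  have BX: "b \<in> X" "- b \<in> X" if "b \<in> B" for b using that BB by (auto simp: X M)
  have "(\<Sum>x\<in>fibre B. f x) = (\<Sum>b\<in>{b \<in> B. u \<bullet> b = v \<bullet> b}. f b)"
  \<comment> \<open>Of \<open>b\<close> and \<open>- b\<close>, the one with positive inner product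
    with \<open>u\<close> is the fibre point; evenness of \<open>f\<close> makes the sign
    harmless.\<close>
  proof (rule sum.reindex_bij_witness[where i = "\<lambda>b. if u \<bullet> b > 0 then b else - b"
        and j = "\<lambda>x. if x \<in> B then x else - x"])
    fix b assume "b \<in> {b \<in> B. u \<bullet> b = v \<bullet> b}"
    then have b: "b \<in> B" "u \<bullet> b = v \<bullet> b" by auto
    show "(if u \<bullet> b > 0 then b else - b) \<in> fibre B"
      using b inner_other_basis[OF B b(1)] BX[OF b(1)] by (auto simp: fibre_def mem_Y' abs_if split: if_splits)
    show "(if (if u \<bullet> b > 0 then b else - b) \<in> B then if u \<bullet> b > 0 then b else - b
        else - (if u \<bullet> b > 0 then b else - b)) = b"
      using neg[OF b(1)] b by auto
  qed (use inner_Y' sqrt_N(2) even in \<open>auto simp: fibre_def\<close>)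
  also have "\<dots> = (\<Sum>b\<in>B. if u \<bullet> b = v \<bullet> b then f b else 0)"
    using finite_basis[OF BB] by (simp add: sum.inter_filter)
  also have "\<dots> = (\<Sum>b\<in>B. (1 + N * ((u \<bullet> b) * (v \<bullet> b))) / 2 * f b)"
  proof (intro sum.cong refl)
    fix b assume b: "b \<in> B"
    note ib = inner_other_basis[OF B b]
    show "(if u \<bullet> b = v \<bullet> b then f b else 0) = (1 + N * ((u \<bullet> b) * (v \<bullet> b))) / 2 * f b"
    proof (cases "u \<bullet> b = v \<bullet> b")
      case True
      then show ?thesis using inner_squared[OF ib(2)] N_gt by simp
    next
      case False
      then have "u \<bullet> b = - (v \<bullet> b)" using ib by linarith
      then show ?thesis using False inner_squared[OF ib(2)] N_gt by simp
    qed
  qed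
  finally show ?thesis .
qed

text \<open>The signed part of the weight sums to zero, since Parseval turns it into a multiple of
  \<open>u \<bullet> v\<close>.\<close>

lemma card_fibre:
  assumes B: "B \<in> \<B> - {B0}"
  shows "real (card (fibre B)) = N / 2"
proof -
  have "real (card (fibre B)) = (\<Sum>b\<in>B. (1 + N * ((u \<bullet> b) * (v \<bullet> b))) / 2)"
    using sum_fibre[OF B, of "\<lambda>_. 1"] by simp
  also have "\<dots> = (real (card B) + N * (\<Sum>b\<in>B. (u \<bullet> b) * (v \<bullet> b))) / 2"
    by (simp add: sum.distrib sum_distrib_left flip: sum_divide_distrib)
  finally show ?thesis
    using B orthonormal_basis_parseval[OF basis, of B u v] uv card_basis by simp
qed

lemma card_Y': "real (card Y') = N\<^sup>2 / 4"
  using sum_Y'[of "\<lambda>_. 1 :: real"] card_fibre card_other_bases[OF B0(1)]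
  by (simp add: power2_eq_square)

text \<open>The constant part of the weight gives \<open>(w \<bullet> w') / 2\<close> for each of
  N/2 bases by Parseval. The signed part gives the fourth moment of \<open>u, v, w, w'\<close> over
  \<open>M\<close>, which is zero because each pairing contains an orthogonal pair;
  \<open>B0\<close> adds nothing to that moment.\<close>

lemma Y'_frame:
  assumes "u \<bullet> w = 0" "v \<bullet> w = 0" "u \<bullet> w' = 0" "v \<bullet> w' = 0"
  shows "(\<Sum>x\<in>Y'. (x \<bullet> w) * (x \<bullet> w')) = N / 4 * (w \<bullet> w')"
proof -
  let ?g = "\<lambda>b. (b \<bullet> u) * (b \<bullet> v) * (b \<bullet> w) * (b \<bullet> w')"
  have "(\<Sum>b\<in>B0. ?g b) = 0"
    using inner_B0 by (intro sum.neutral) (auto simp: inner_commute)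
  then have "(\<Sum>B\<in>\<B> - {B0}. \<Sum>b\<in>B. ?g b) = (\<Sum>b\<in>M. ?g b)"
    by (simp add: sum_M sum.remove[OF finite_bases B0(1)])
  also have "\<dots> = 0"
    using assms uv by (simp add: M_fourth_moment)
  finally have g: "(\<Sum>B\<in>\<B> - {B0}. \<Sum>b\<in>B. ?g b) = 0" .
  have "(\<Sum>x\<in>fibre B. (x \<bullet> w) * (x \<bullet> w')) = (w \<bullet> w') / 2 + N / 2 * (\<Sum>b\<in>B. ?g b)"
    if B: "B \<in> \<B> - {B0}" for B
  proof -
    have "(\<Sum>x\<in>fibre B. (x \<bullet> w) * (x \<bullet> w')) =
        (\<Sum>b\<in>B. (w \<bullet> b) * (w' \<bullet> b) / 2 + N / 2 * ?g b)"
      by (subst sum_fibre[OF B]) (auto intro!: sum.cong simp: inner_commute field_simps)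
    then show ?thesis
      using B orthonormal_basis_parseval[OF basis, of B w w']
      by (simp add: sum.distrib sum_distrib_left flip: sum_divide_distrib)
  qed
  then have "(\<Sum>x\<in>Y'. (x \<bullet> w) * (x \<bullet> w')) =
      (\<Sum>B\<in>\<B> - {B0}. (w \<bullet> w') / 2 + N / 2 * (\<Sum>b\<in>B. ?g b))"
    by (simp add: sum_Y')
  also have "\<dots> = real (card (\<B> - {B0})) * ((w \<bullet> w') / 2) + N / 2 * (\<Sum>B\<in>\<B> - {B0}. \<Sum>b\<in>B. ?g b)"
    by (simp add: sum.distrib sum_distrib_left)
  finally show ?thesis
    unfolding g card_other_bases[OF B0(1)] by simp
qed

text \<open>Closed form of the rescaled projection on \<open>Y'\<close>: the component along
  \<open>u\<close> and \<open>v\<close> is \<open>(u + v) / sqrt N\<close>, and the remainder has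
  squared norm 1 - 2/N.\<close>

definition proj :: "real ^ 'n \<Rightarrow> real ^ 'n" where
  "proj x = sqrt (N / (N - 2)) *\<^sub>R (x - (1 / sqrt N) *\<^sub>R (u + v))"

lemma inner_proj_raw:
  assumes "x \<in> Y'" "y \<in> Y'"
  shows "(x - (1 / sqrt N) *\<^sub>R (u + v)) \<bullet> (y - (1 / sqrt N) *\<^sub>R (u + v)) = x \<bullet> y - 2 / N"
proof -
  let ?t = "1 / sqrt N"
  have t: "?t * ?t = 1 / N" using inner_squared[of ?t] N_gt by simp
  have "(x - ?t *\<^sub>R (u + v)) \<bullet> (y - ?t *\<^sub>R (u + v)) =
      x \<bullet> y - ?t * (u \<bullet> x + v \<bullet> x) - ?t * (u \<bullet> y + v \<bullet> y)
        + (?t * ?t) * (u \<bullet> u + v \<bullet> v + 2 * (u \<bullet> v))"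
    by (simp add: inner_diff_left inner_diff_right inner_add_left inner_add_right
        inner_commute[of x] inner_commute[of v u] algebra_simps)
  also have "\<dots> = x \<bullet> y - 2 * (?t * ?t)"
    unfolding inner_Y'[OF assms(1)] inner_Y'[OF assms(2)] u_v_unit uv by (simp add: algebra_simps)
  finally show ?thesis unfolding t by simp
qed

lemma inner_proj:
  assumes "x \<in> Y'" "y \<in> Y'"
  shows "proj x \<bullet> proj y = (N * (x \<bullet> y) - 2) / (N - 2)"
proof -
  have "proj x \<bullet> proj y = sqrt (N / (N - 2)) * sqrt (N / (N - 2)) * (x \<bullet> y - 2 / N)"
    unfolding proj_def by (simp add: inner_proj_raw[OF assms] del: real_sqrt_mult_self)
  also have "sqrt (N / (N - 2)) * sqrt (N / (N - 2)) = N / (N - 2)" using N_gt by simp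
  also have "N / (N - 2) * (x \<bullet> y - 2 / N) = (N * (x \<bullet> y) - 2) / (N - 2)"
    using N_gt by (simp add: field_simps)
  finally show ?thesis .
qed

lemma inner_proj_u_v:
  assumes "x \<in> Y'"
  shows "u \<bullet> proj x = 0" "v \<bullet> proj x = 0"
  using inner_Y'[OF assms] u_v_unit uv
  by (simp_all add: proj_def inner_diff_right inner_add_right inner_commute[of v u])

lemma inj_proj: "inj_on proj Y'"
  using N_gt by (intro inj_onI) (simp add: proj_def)

lemma Y'_unit: "x \<in> Y' \<Longrightarrow> x \<bullet> x = 1"
  using M_unit by (auto simp: Y' X)

lemma rescaled_projection:
  assumes "x \<in> Y'"
  shows "rescale_to_unit (orthogonal_projection ((span {u, v})\<^sup>\<bottom>) x) = proj x"
proof -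
  let ?p = "x - (1 / sqrt N) *\<^sub>R (u + v)"
  have "orthogonal_projection ((span {u, v})\<^sup>\<bottom>) x = ?p"
    unfolding orthogonal_projection_orthogonal_comp_span[OF u_v_unit uv] inner_Y'[OF assms]
    by (simp add: scaleR_add_right)
  moreover have "norm ?p = sqrt ((N - 2) / N)"
    unfolding norm_eq_sqrt_inner inner_proj_raw[OF assms assms] Y'_unit[OF assms]
    using N_gt by (simp add: field_simps)
  ultimately show ?thesis
    by (simp add: rescale_to_unit_def proj_def real_sqrt_divide)
qed

lemma linked_simplices_proj:
  assumes \<alpha>: "\<alpha> = (- sqrt N - 2) / (N - 2)"
    and \<beta>: "\<beta> = (sqrt N - 2) / (N - 2)"
    and \<gamma>: "\<gamma> = - 2 / (N - 2)"
    and R: "R = (\<lambda>i. [Id_on (proj ` Y'), inner_product_relation (proj ` Y') \<alpha>,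
      inner_product_relation (proj ` Y') \<beta>, inner_product_relation (proj ` Y') \<gamma>] ! i)"
    and P: "P = (\<lambda>i j.
      [[1, (N - 2 * sqrt N) * (N - 2) / 8, (N + 2 * sqrt N) * (N - 2) / 8, N / 2 - 1],
       [1, - (sqrt N * (N - 4) / 8),       sqrt N * (N - 4) / 8,           - 1],
       [1, sqrt N / 2,                     - (sqrt N / 2),                 - 1],
       [1, - ((N - 2 * sqrt N) / 4),       - ((N + 2 * sqrt N) / 4),       N / 2 - 1]] ! i ! j)"
    and Q: "Q = (\<lambda>i j.
      [[1, N - 2,        (N - 2) * (N - 4) / 4, N / 2 - 1],
       [1, - sqrt N - 2, sqrt N + 2,            - 1],
       [1, sqrt N - 2,   - sqrt N + 2,          - 1],
       [1, - 2,          - (N / 2) + 2,         N / 2 - 1]] ! i ! j)"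
  shows "linked_simplices (proj ` Y') N \<alpha> \<beta> \<gamma> R P Q"
proof -
  \<comment> \<open>\<gamma> is the image of inner product zero, which identifies fibres with
    orthogonality classes of \<open>Y'\<close>.\<close>
  have gamma_iff: "proj x \<bullet> proj y = \<gamma> \<longleftrightarrow> x \<bullet> y = 0" if "x \<in> Y'" "y \<in> Y'" for x y
    using N_gt by (simp add: inner_proj[OF that] \<gamma> divide_simps)
  have same: "x = y \<or> x \<bullet> y = 0 \<longleftrightarrow> y \<in> fibre B" if x: "x \<in> fibre B" and B: "B \<in> \<B>" and y: "y \<in> Y'" for x y B
  proof -
    obtain B' where B': "B' \<in> \<B> - {B0}" "y \<in> fibre B'" using Y'_fibre[OF y] .
    show ?thesis
    proof (cases "B = B'")
      case True
      then show ?thesis using inner_same_fibre[OF B x] B' by auto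
    next
      case False
      then have "y \<notin> fibre B" using fibres_disjoint[of B B'] B B' by auto
      then show ?thesis using inner_different_fibres[OF B _ False x B'(2)] B' x N_gt by auto
    qed
  qed
  show ?thesis
  proof
    show "real (card (proj ` Y')) = N\<^sup>2 / 4"
      using card_image[OF inj_proj] card_Y' by simp
    show "x \<bullet> x = 1" if "x \<in> proj ` Y'" for x
      using that N_gt by (auto simp: inner_proj Y'_unit)
    show "x \<bullet> y \<in> {\<alpha>, \<beta>, \<gamma>}" if xy: "x \<in> proj ` Y'" "y \<in> proj ` Y'" "x \<noteq> y" for x y
    proof -
      obtain a b where ab: "a \<in> Y'" "b \<in> Y'" "x = proj a" "y = proj b" using xy by blast
      obtain A where A: "A \<in> \<B> - {B0}" "a \<in> fibre A" using Y'_fibre[OF ab(1)] .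
      obtain B where B: "B \<in> \<B> - {B0}" "b \<in> fibre B" using Y'_fibre[OF ab(2)] .
      consider "a \<bullet> b = 0" | "a \<bullet> b = 1 / sqrt N" | "a \<bullet> b = - (1 / sqrt N)"
      proof (cases "A = B")
        case True
        then have "a \<bullet> b = 0" using inner_same_fibre[of A a b] A B ab xy(3) by auto
        then show thesis using that by blast
      next
        case False
        then have "\<bar>a \<bullet> b\<bar> = 1 / sqrt N" using inner_different_fibres A B by auto
        then show thesis using that by (auto simp: abs_if split: if_splits)
      qed
      \<comment> \<open>This carries the inner products \<open>1 / sqrt N\<close> and
        \<open>- (1 / sqrt N)\<close> to \<beta> and \<alpha>.\<close>
      moreover have "N * (1 / sqrt N) = sqrt N" using N_gt by (simp add: real_div_sqrt)
      ultimately show ?thesis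
        unfolding ab(3,4) inner_proj[OF ab(1,2)] \<alpha> \<beta> \<gamma> by cases auto
    qed
    show "x \<bullet> z = \<gamma>"
      if xyz: "x \<in> proj ` Y'" "y \<in> proj ` Y'" "z \<in> proj ` Y'" "x \<bullet> y = \<gamma>" "y \<bullet> z = \<gamma>" "x \<noteq> z" for x y z
    proof -
      obtain a b c where abc: "a \<in> Y'" "b \<in> Y'" "c \<in> Y'" "x = proj a" "y = proj b" "z = proj c"
        using xyz by blast
      obtain B where B: "B \<in> \<B> - {B0}" "b \<in> fibre B" using Y'_fibre[OF abc(2)] .
      have "a \<in> fibre B" "c \<in> fibre B"
        using same[OF B(2) _ abc(1)] same[OF B(2) _ abc(3)] B(1) abc xyz
        by (simp_all add: gamma_iff inner_commute[of b])
      then show ?thesis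
        using same[of a B c] B abc xyz by (simp add: gamma_iff) metis
    qed
    show "real (card {z \<in> proj ` Y'. x = z \<or> x \<bullet> z = \<gamma>}) = N / 2" if x: "x \<in> proj ` Y'" for x
    proof -
      obtain a where a: "a \<in> Y'" "x = proj a" using x by blast
      obtain A where A: "A \<in> \<B> - {B0}" "a \<in> fibre A" using Y'_fibre[OF a(1)] .
      have iff: "(x = proj b \<or> x \<bullet> proj b = \<gamma>) \<longleftrightarrow> b \<in> fibre A" if "b \<in> Y'" for b
        using same[OF A(2) _ that] A(1) inj_on_eq_iff[OF inj_proj a(1) that]
        by (simp add: a gamma_iff[OF a(1) that])
      have "{z \<in> proj ` Y'. x = z \<or> x \<bullet> z = \<gamma>} = proj ` fibre A"
      proof (intro equalityI subsetI)
        fix z assume "z \<in> proj ` fibre A"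
        then show "z \<in> {z \<in> proj ` Y'. x = z \<or> x \<bullet> z = \<gamma>}"
          using iff by (auto simp: fibre_def)
      qed (use iff in auto)
      moreover have "inj_on proj (fibre A)"
        using inj_proj by (rule inj_on_subset) (auto simp: fibre_def)
      ultimately show ?thesis using card_fibre[OF A(1)] by (simp add: card_image)
    qed
    show "(\<Sum>z\<in>proj ` Y'. (x \<bullet> z) * (z \<bullet> y)) = N\<^sup>2 / (4 * (N - 2)) * (x \<bullet> y)"
      if xy: "x \<in> proj ` Y'" "y \<in> proj ` Y'" for x y
    proof -
      let ?c = "sqrt (N / (N - 2))"
      have orth: "u \<bullet> x = 0" "v \<bullet> x = 0" "u \<bullet> y = 0" "v \<bullet> y = 0"
        using xy inner_proj_u_v by auto
      have "(\<Sum>z\<in>proj ` Y'. (x \<bullet> z) * (z \<bullet> y)) = (\<Sum>a\<in>Y'. (x \<bullet> proj a) * (proj a \<bullet> y))"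
        using inj_proj by (simp add: sum.reindex)
      also have "\<dots> = (\<Sum>a\<in>Y'. (?c * ?c) * ((a \<bullet> x) * (a \<bullet> y)))"
      proof (intro sum.cong refl)
        fix a
        \<comment> \<open>The subtracted multiple of \<open>u + v\<close> disappears because
          \<open>x\<close> and \<open>y\<close> are orthogonal to \<open>u\<close> and
          \<open>v\<close>.\<close>
        have "x \<bullet> proj a = ?c * (a \<bullet> x)" "proj a \<bullet> y = ?c * (a \<bullet> y)"
          unfolding proj_def using orth
          by (simp_all add: inner_diff_left inner_diff_right inner_add_left inner_add_right
              inner_commute[of x])
        then show "(x \<bullet> proj a) * (proj a \<bullet> y) = (?c * ?c) * ((a \<bullet> x) * (a \<bullet> y))" by (simp only: mult_ac)
      qed
      also have "?c * ?c = N / (N - 2)" using N_gt by simp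
      also have "(\<Sum>a\<in>Y'. N / (N - 2) * ((a \<bullet> x) * (a \<bullet> y))) = N / (N - 2) * (N / 4 * (x \<bullet> y))"
        unfolding sum_distrib_left[symmetric] Y'_frame[OF orth] ..
      also have "\<dots> = N\<^sup>2 / (4 * (N - 2)) * (x \<bullet> y)"
        using N_gt by (simp add: field_simps power2_eq_square)
      finally show ?thesis .
    qed
  qed (use assms N_gt in simp_all)
qed

end

theorem theorem5:
  fixes \<B> :: "(real ^ 'n) set set"
    and M X Y' Y :: "(real ^ 'n) set"
    and u v :: "real ^ 'n"
    and N \<alpha> \<beta> \<gamma> :: real
    and R :: "nat \<Rightarrow> ((real ^ 'n) \<times> (real ^ 'n)) set"
    and P Q :: "nat \<Rightarrow> nat \<Rightarrow> real"
  assumes "N = real CARD('n)" and "N > 2"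
    and "maximal_mub_collection \<B>"
    and "M = \<Union>\<B>"
    and "X = M \<union> uminus ` M"
    and "u \<in> X" and "v \<in> X" and "u \<bullet> v = 0"
    and "Y' = {x \<in> X. u \<bullet> x = 1 / sqrt N \<and> v \<bullet> x = 1 / sqrt N}"
    and "Y = (\<lambda>x. rescale_to_unit (orthogonal_projection ((span {u, v})\<^sup>\<bottom>) x)) ` Y'"
    and "\<alpha> = (- sqrt N - 2) / (N - 2)"
    and "\<beta> = (sqrt N - 2) / (N - 2)"
    and "\<gamma> = - 2 / (N - 2)"
    and "R = (\<lambda>i. [Id_on Y, inner_product_relation Y \<alpha>, inner_product_relation Y \<beta>,
                    inner_product_relation Y \<gamma>] ! i)"
    and "P = (\<lambda>i j.
      [[1, (N - 2 * sqrt N) * (N - 2) / 8, (N + 2 * sqrt N) * (N - 2) / 8, N / 2 - 1],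
       [1, - (sqrt N * (N - 4) / 8),       sqrt N * (N - 4) / 8,           - 1],
       [1, sqrt N / 2,                     - (sqrt N / 2),                 - 1],
       [1, - ((N - 2 * sqrt N) / 4),       - ((N + 2 * sqrt N) / 4),       N / 2 - 1]] ! i ! j)"
    and "Q = (\<lambda>i j.
      [[1, N - 2,        (N - 2) * (N - 4) / 4, N / 2 - 1],
       [1, - sqrt N - 2, sqrt N + 2,            - 1],
       [1, sqrt N - 2,   - sqrt N + 2,          - 1],
       [1, - 2,          - (N / 2) + 2,         N / 2 - 1]] ! i ! j)"
  shows "(\<forall>x\<in>Y. \<forall>y\<in>Y. x \<noteq> y \<longrightarrow> x \<bullet> y \<in> {\<alpha>, \<beta>, \<gamma>}) \<and>
    (N \<noteq> 4 \<longrightarrow> association_scheme Y 3 R \<and> eigenmatrices Y 3 R P Q) \<and>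
    (N = 4 \<longrightarrow> weak_association_scheme Y 3 R \<and> weak_eigenmatrices Y 3 R P Q)"
proof -
  obtain B where B: "B \<in> \<B>" "u \<in> B \<union> uminus ` B" using assms(4-6) by blast
  obtain C where C: "C \<in> \<B>" "v \<in> C \<union> uminus ` C" using assms(4,5,7) by blast
  \<comment> \<open>Vectors from two different bases have nonzero inner product, so orthogonality
    puts \<open>u\<close> and \<open>v\<close> in the same basis up to sign.\<close>
  have "C = B"
  proof (rule ccontr)
    assume "C \<noteq> B"
    then have "mutually_unbiased B C"
      using B C assms(3) by (auto simp: maximal_mub_collection_def pairwise_def)
    then have "\<bar>u \<bullet> v\<bar> = 1 / sqrt N"
      using B C by (auto simp: mutually_unbiased_def assms(1))
    then show False using assms(2,8) by simp
  qed
  then interpret mub_orthogonal_pair \<B> B M X Y' u v N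
    using assms B C by unfold_locales auto
  have Y: "Y = proj ` Y'"
    unfolding assms(10) by (rule image_cong) (simp_all add: rescaled_projection)
  interpret S: linked_simplices Y N \<alpha> \<beta> \<gamma> R P Q
    unfolding Y by (rule linked_simplices_proj) (use assms(11-16) in \<open>simp_all only: Y\<close>)
  show ?thesis
    \<comment> \<open>The weak statements hold for all N > 2; N \<noteq> 4 enters only through
      nonempty relations and nonzero idempotents.\<close>
    using S.three_distances S.association_scheme_and_eigenmatrices
      S.weak_association_scheme S.weak_eigenmatrices by simp
qed

end
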